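(* For $n\ge 2$ let $G_n$ be the mean-field model of distance: the complete graph on $n$ vertices whose edges are assigned i.i.d. random lengths with the Exponential distribution of mean $n$. Let $L_{NUV}(G_n)$ be the length of the nearest unvisited vertex walk on $G_n$ from an arbitrary initial vertex. Then the sequence of random variables $(n^{-1}L_{NUV}(G_n),\ n\ge 2)$ is tight.
   Context: In a finite connected graph with positive edge-lengths, the length of a path is the sum of its edge-lengths, and the distance $d(v,w)$ between two vertices is the length of the shortest path between them. (In $G_n$ all distances between pairs of distinct vertices are almost surely distinct.) The nearest unvisited vertex (NUV) walk on an $n$-vertex graph $G$ from initial vertex $v_0$ is the deterministic walk which, after arriving at a vertex, next moves along the shortest path to the closest (in the distance $d$) unvisited vertex, until every vertex has been visited. Explicitly, the vertices in order of first visit are $v_0,v_1,\ldots,v_{n-1}$ where $v_i = \arg\min_{v\notin\{v_0,\ldots,v_{i-1}\}} d(v_{i-1},v)$ for $1\le i\le n-1$, and its length is $L_{NUV}(G,v_0)=\sum_{i=1}^{n-1} d(v_{i-1},v_i)$. In the notation $L_{NUV}(G_n)$ the initial vertex is suppressed. A sequence of real random variables $(X_n)$ is tight if $\lim_{K\to\infty}\sup_n \mathbb{P}(|X_n|>K)=0$. *)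

theory Defs
  imports "HOL-Probability.Probability" "HOL-Library.Ramsey"
begin

text \<open>A graph is given by a vertex set, a set of two-element vertex sets as edges, and a
  length function on edges. Paths are lists of pairwise distinct vertices, so a finite graph has
  only finitely many of them and the minimum below is attained as soon as the graph is connected.\<close>

definition is_path :: "'v set \<Rightarrow> 'v set set \<Rightarrow> 'v \<Rightarrow> 'v \<Rightarrow> 'v list \<Rightarrow> bool" where
  "is_path V E u v xs \<longleftrightarrow>
     xs \<noteq> [] \<and> hd xs = u \<and> last xs = v \<and> distinct xs \<and> set xs \<subseteq> V \<and>
     (\<forall>i. Suc i < length xs \<longrightarrow> {xs ! i, xs ! Suc i} \<in> E)"

definition path_length :: "('v set \<Rightarrow> real) \<Rightarrow> 'v list \<Rightarrow> real" where
  "path_length len xs = (\<Sum>i<length xs - 1. len {xs ! i, xs ! Suc i})"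

definition graph_dist :: "'v set \<Rightarrow> 'v set set \<Rightarrow> ('v set \<Rightarrow> real) \<Rightarrow> 'v \<Rightarrow> 'v \<Rightarrow> real" where
  "graph_dist V E len u v = Min (path_length len ` {xs. is_path V E u v xs})"

text \<open>If several unvisited vertices are equally close, the choice between them is left to
  \<^const>\<open>arg_min_on\<close>; it depends only on the set of closest unvisited vertices.\<close>

fun nuv_vertex :: "'v set \<Rightarrow> ('v \<Rightarrow> 'v \<Rightarrow> real) \<Rightarrow> 'v \<Rightarrow> nat \<Rightarrow> 'v" where
  "nuv_vertex V d v0 0 = v0"
| "nuv_vertex V d v0 (Suc i) =
     arg_min_on (d (nuv_vertex V d v0 i)) (V - nuv_vertex V d v0 ` {0..i})"

definition L_NUV :: "'v set \<Rightarrow> 'v set set \<Rightarrow> ('v set \<Rightarrow> real) \<Rightarrow> 'v \<Rightarrow> real" where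
  "L_NUV V E len v0 =
     (let d = graph_dist V E len; v = nuv_vertex V d v0
      in \<Sum>i=1..card V - 1. d (v (i - 1)) (v i))"

definition complete_edges :: "nat \<Rightarrow> nat set set" where
  "complete_edges n = nsets {..<n} 2"

text \<open>The parameter of \<^const>\<open>exponential_density\<close> is the rate, so mean \<open>n\<close> is rate \<open>1 / n\<close>.\<close>

definition mean_field_model :: "nat \<Rightarrow> 'a measure \<Rightarrow> (nat set \<Rightarrow> 'a \<Rightarrow> real) \<Rightarrow> bool" where
  "mean_field_model n M len \<longleftrightarrow>
     prob_space M \<and>
     prob_space.indep_vars M (\<lambda>_. borel) len (complete_edges n) \<and>
     (\<forall>e\<in>complete_edges n. distributed M lborel (len e) (exponential_density (1 / real n)))"

text \<open>The random variables may live on different probability spaces. Measurability is part of the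
  definition, so that the probabilities are those of genuine events.\<close>

definition tight_rvs :: "nat set \<Rightarrow> (nat \<Rightarrow> 'a measure) \<Rightarrow> (nat \<Rightarrow> 'a \<Rightarrow> real) \<Rightarrow> bool" where
  "tight_rvs I M X \<longleftrightarrow>
     (\<forall>n\<in>I. X n \<in> borel_measurable (M n)) \<and>
     ((\<lambda>K. SUP n\<in>I. measure (M n) {\<omega> \<in> space (M n). \<bar>X n \<omega>\<bar> > K}) \<longlongrightarrow> 0) at_top"

text \<open>Agreement with the library's notion of tightness for sequences of distributions.\<close>

lemma tight_rvs_iff_tight:
  assumes ps: "\<And>n. prob_space (M n)"
  shows "tight_rvs UNIV M X \<longleftrightarrow>
    (\<forall>n. X n \<in> borel_measurable (M n)) \<and> tight (\<lambda>n. distr (M n) borel (X n))"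
proof (cases "\<forall>n. X n \<in> borel_measurable (M n)")
  case False
  then show ?thesis by (auto simp: tight_rvs_def)
next
  case True
  then have meas [measurable]: "X n \<in> borel_measurable (M n)" for n by blast
  define p where "p K n = measure (M n) {\<omega> \<in> space (M n). \<bar>X n \<omega>\<bar> > K}" for K n
  have p01: "0 \<le> p K n" "p K n \<le> 1" for K n
    using prob_space.prob_le_1[OF ps] by (auto simp: p_def)
  have bdd: "bdd_above (range (p K))" for K
    using p01 by (intro bdd_aboveI[of _ 1]) auto
  have le_SUP: "p K n \<le> (SUP n. p K n)" for K n
    using bdd by (intro cSUP_upper) auto
  have compl: "measure (M n) {\<omega> \<in> space (M n). \<not> P \<omega>} = 1 - measure (M n) {\<omega> \<in> space (M n). P \<omega>}"
    if "{\<omega> \<in> space (M n). P \<omega>} \<in> sets (M n)" for n P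
    using prob_space.prob_neg[OF ps that] .
  have dist: "measure (distr (M n) borel (X n)) {a<..b} =
      measure (M n) {\<omega> \<in> space (M n). a < X n \<omega> \<and> X n \<omega> \<le> b}" for a b n
    by (subst measure_distr) (auto intro!: arg_cong[where f = "measure (M n)"])
  have rd: "real_distribution (distr (M n) borel (X n))" for n
    by (rule prob_space.real_distribution_distr[OF ps]) simp
  have "((\<lambda>K. SUP n. p K n) \<longlongrightarrow> 0) at_top \<longleftrightarrow>
    (\<forall>\<epsilon>>0. \<exists>a b. a < b \<and> (\<forall>n. 1 - \<epsilon> < measure (distr (M n) borel (X n)) {a<..b}))"
  proof (intro iffI allI impI)
    fix \<epsilon> :: real assume \<epsilon>: "\<epsilon> > 0" and lim: "((\<lambda>K. SUP n. p K n) \<longlongrightarrow> 0) at_top"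
    have "eventually (\<lambda>K. (SUP n. p K n) < \<epsilon> \<and> K > 0) at_top"
      by (intro eventually_conj order_tendstoD(2)[OF lim \<epsilon>] eventually_gt_at_top)
    then obtain K where K: "(SUP n. p K n) < \<epsilon>" "K > 0"
      by (metis (mono_tags, lifting) eventually_happens' trivial_limit_at_top_linorder)
    have "1 - \<epsilon> < measure (distr (M n) borel (X n)) {-K-1<..K}" for n
    proof -
      interpret prob_space "M n" by (rule ps)
      have "1 - p K n = measure (M n) {\<omega> \<in> space (M n). \<not> \<bar>X n \<omega>\<bar> > K}"
        unfolding p_def by (rule compl[symmetric]) measurable
      also have "\<dots> \<le> measure (M n) {\<omega> \<in> space (M n). -K-1 < X n \<omega> \<and> X n \<omega> \<le> K}"
        by (rule finite_measure_mono) (auto simp: abs_le_iff)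
      finally show ?thesis using le_SUP[of K n] K by (simp add: dist)
    qed
    then show "\<exists>a b. a < b \<and> (\<forall>n. 1 - \<epsilon> < measure (distr (M n) borel (X n)) {a<..b})"
      using K by (intro exI[of _ "-K-1"] exI[of _ K]) auto
  next
    assume *: "\<forall>\<epsilon>>0. \<exists>a b. a < b \<and> (\<forall>n. 1 - \<epsilon> < measure (distr (M n) borel (X n)) {a<..b})"
    show "((\<lambda>K. SUP n. p K n) \<longlongrightarrow> 0) at_top"
    proof (rule order_tendstoI)
      fix a :: real assume "a < 0"
      then have "a < (SUP n. p K n)" for K using le_SUP[of K 0] p01(1)[of K 0] by linarith
      then show "eventually (\<lambda>K. a < (SUP n. p K n)) at_top" by simp
    next
      fix \<epsilon> :: real assume \<epsilon>: "0 < \<epsilon>"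
      then obtain a b where ab: "1 - \<epsilon>/2 < measure (distr (M n) borel (X n)) {a<..b}" for n
        using *[rule_format, of "\<epsilon>/2"] by auto
      have "(SUP n. p K n) < \<epsilon>" if "K \<ge> max \<bar>a\<bar> \<bar>b\<bar>" for K
      proof -
        have "p K n \<le> \<epsilon>/2" for n
        proof -
          interpret prob_space "M n" by (rule ps)
          have "p K n \<le> measure (M n) {\<omega> \<in> space (M n). \<not> (a < X n \<omega> \<and> X n \<omega> \<le> b)}"
            unfolding p_def by (rule finite_measure_mono) (use that in auto)
          also have "\<dots> = 1 - measure (distr (M n) borel (X n)) {a<..b}"
            unfolding dist by (rule compl) measurable
          finally show ?thesis using ab[of n] by linarith
        qed
        then have "(SUP n. p K n) \<le> \<epsilon>/2" by (intro cSUP_least) auto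
        then show ?thesis using \<epsilon> by linarith
      qed
      then show "eventually (\<lambda>K. (SUP n. p K n) < \<epsilon>) at_top"
        using eventually_at_top_linorder by blast
    qed
  qed
  then show ?thesis
    using True rd by (simp add: tight_rvs_def tight_def p_def)
qed

end

theory Submission
  imports Defs "HOL-Real_Asymp.Real_Asymp"
begin

text \<open>The starting points of the steps of length more than \<open>r\<close> are pairwise more than \<open>r\<close>
  apart, so any neighbourhoods of diameter scale \<open>r\<close> around them are disjoint. With
  \<open>r = 128 k\<close>, take as neighbourhood the set of vertices reachable by two edges of length at
  most \<open>32 k\<close>. In the mean-field model a vertex has about \<open>32 k\<close> such edges and, given these,
  about \<open>(32 k)\<^sup>2\<close> vertices at the second level, and Chernoff bounds show that it has fewer than
  \<open>k\<^sup>2\<close> of them with probability at most \<open>4 / k\<^sup>2\<close>. Hence the expected number of steps longer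
  than \<open>128 k\<close> is at most \<open>5 n / k\<^sup>2\<close>, as long as \<open>16 k\<^sup>2 \<le> n\<close>. Summing over dyadic \<open>k\<close> up to
  order \<open>\<surd>n\<close> gives a total expected length of order \<open>n\<close>, where the boundedly many
  longer steps cost at most \<open>2 n\<close> each because outside an event of exponentially small
  probability any two vertices are joined by two edges of length at most \<open>n\<close>.\<close>

subsection \<open>Graph distance and the walk\<close>

lemma path_length_singleton [simp]: "path_length len [x] = 0"
  by (simp add: path_length_def)

lemma path_length_Cons2:
  "path_length len (x # y # xs) = len {x, y} + path_length len (y # xs)"
  by (simp add: path_length_def sum.lessThan_Suc_shift del: sum.lessThan_Suc)

lemma is_path_singleton [simp]: "is_path V E u v [x] \<longleftrightarrow> u = x \<and> v = x \<and> x \<in> V"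
  by (auto simp: is_path_def)

lemma is_path_Cons2:
  "is_path V E u v (x # y # xs) \<longleftrightarrow>
     u = x \<and> x \<in> V \<and> x \<notin> set (y # xs) \<and> {x, y} \<in> E \<and> is_path V E y v (y # xs)"
proof -
  have "(\<forall>i. Suc i < length (x # y # xs) \<longrightarrow> {(x # y # xs) ! i, (x # y # xs) ! Suc i} \<in> E) \<longleftrightarrow>
    {x, y} \<in> E \<and> (\<forall>i. Suc i < length (y # xs) \<longrightarrow> {(y # xs) ! i, (y # xs) ! Suc i} \<in> E)"
    by (auto simp: less_Suc_eq_0_disj nth_Cons split: nat.splits)
  then show ?thesis by (auto simp: is_path_def)
qed


context
  fixes V :: "'v set" and E :: "'v set set" and len :: "'v set \<Rightarrow> real"
  assumes fin: "finite V" and nonneg: "\<And>e. e \<in> E \<Longrightarrow> 0 \<le> len e"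
begin

lemma finite_paths: "finite {xs. is_path V E u v xs}"
  by (rule finite_subset[OF _ finite_subset_distinct[OF fin]]) (auto simp: is_path_def)

lemma path_length_nonneg: "is_path V E u v xs \<Longrightarrow> 0 \<le> path_length len xs"
  unfolding path_length_def is_path_def by (intro sum_nonneg nonneg) auto

text \<open>Dropping the first edge of a path subtracts a nonnegative length, hence the induction on
  the part cut off. Used in \<open>graph_dist_step\<close> to shorten a path that already meets the
  new vertex.\<close>

lemma is_path_suffix:
  assumes "is_path V E u v (as @ w # bs)"
  shows "is_path V E w v (w # bs) \<and> path_length len (w # bs) \<le> path_length len (as @ w # bs)"
  using assms
proof (induction as arbitrary: u)
  case Nil
  then show ?case by (auto simp: is_path_def)
next
  case (Cons a as)
  obtain b cs where bc: "as @ w # bs = b # cs" by (cases "as @ w # bs") auto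
  with Cons.prems have "{a, b} \<in> E" "is_path V E b v (as @ w # bs)"
    by (auto simp: is_path_Cons2)
  with Cons.IH[of b] nonneg[of "{a, b}"] bc show ?case
    by (auto simp: path_length_Cons2)
qed

lemma graph_dist_le: "is_path V E u v xs \<Longrightarrow> graph_dist V E len u v \<le> path_length len xs"
  unfolding graph_dist_def by (intro Min_le finite_imageI finite_paths) auto

lemma graph_dist_attained:
  assumes "is_path V E u v xs"
  obtains ys where "is_path V E u v ys" "graph_dist V E len u v = path_length len ys"
proof -
  have "graph_dist V E len u v \<in> path_length len ` {xs. is_path V E u v xs}"
    unfolding graph_dist_def using assms by (intro Min_in finite_imageI finite_paths) auto
  then show ?thesis using that by auto
qed

lemma graph_dist_refl: "u \<in> V \<Longrightarrow> graph_dist V E len u u \<le> 0"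
  using graph_dist_le[of u u "[u]"] by simp

lemma graph_dist_nonneg: "is_path V E u v xs \<Longrightarrow> 0 \<le> graph_dist V E len u v"
  by (metis graph_dist_attained path_length_nonneg)

text \<open>The triangle inequality for a first step along an edge. Paths have distinct vertices, so
  \<open>w\<close> can be prepended to a shortest path from \<open>u\<close> only if it does not lie
  on it; otherwise the part of that path from \<open>w\<close> on is already short enough.\<close>

lemma graph_dist_step:
  assumes "{w, u} \<in> E" "w \<in> V" "is_path V E u v xs"
  shows "graph_dist V E len w v \<le> len {w, u} + graph_dist V E len u v"
proof -
  obtain ys where ys: "is_path V E u v ys" "graph_dist V E len u v = path_length len ys"
    using graph_dist_attained assms by metis
  show ?thesis
  proof (cases "w \<in> set ys")
    case True
    then obtain as bs where "ys = as @ w # bs" by (meson split_list)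
    with ys is_path_suffix[of u v as w bs] graph_dist_le[of w v "w # bs"] nonneg[OF assms(1)]
    show ?thesis by auto
  next
    case False
    from ys(1) obtain zs where zs: "ys = u # zs" by (cases ys) (auto simp: is_path_def)
    then have "is_path V E w v (w # u # zs)" using ys False assms by (auto simp: is_path_Cons2)
    from graph_dist_le[OF this] ys zs show ?thesis by (simp add: path_length_Cons2)
  qed
qed

end

section \<open>Greedy choice of the walk and the number of its long steps\<close>

text \<open>The first \<open>Suc i\<close> positions cover at most \<open>Suc i\<close> vertices,
  fewer than \<open>card V\<close>, so the set passed to \<open>arg_min_on\<close> is finite and
  nonempty and its minimum is attained. Once nothing is left to visit, the value of
  \<open>arg_min_on\<close> is unspecified, hence the bounds on \<open>i\<close>.\<close>

lemma nuv_vertex_props: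
  assumes "finite V" "v0 \<in> V" "i < card V"
  shows "nuv_vertex V d v0 i \<in> V - nuv_vertex V d v0 ` {..<i}"
    and "\<And>x. Suc i < card V \<Longrightarrow> x \<in> V \<Longrightarrow> x \<notin> nuv_vertex V d v0 ` {..i} \<Longrightarrow>
           d (nuv_vertex V d v0 i) (nuv_vertex V d v0 (Suc i)) \<le> d (nuv_vertex V d v0 i) x"
proof -
  let ?v = "nuv_vertex V d v0"
  have ne: "V - ?v ` {0..i} \<noteq> {}" if "Suc i < card V" for i
  proof
    assume "V - ?v ` {0..i} = {}"
    then have "card V \<le> card (?v ` {0..i})" by (intro card_mono) auto
    also have "\<dots> \<le> Suc i" using card_image_le[of "{0..i}" ?v] by simp
    finally show False using that by simp
  qed
  show "?v i \<in> V - ?v ` {..<i}"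
  proof (cases i)
    case (Suc j)
    have "?v (Suc j) \<in> V - ?v ` {0..j}"
      unfolding nuv_vertex.simps using assms ne[of j] Suc by (intro arg_min_if_finite) auto
    then show ?thesis by (simp add: Suc lessThan_Suc_atMost atLeast0AtMost)
  qed (use assms in auto)
  fix x assume *: "Suc i < card V" "x \<in> V" "x \<notin> ?v ` {..i}"
  have "\<not> (\<exists>x\<in>V - ?v ` {0..i}. d (?v i) x < d (?v i) (?v (Suc i)))"
    unfolding nuv_vertex.simps(2)[of V d v0 i]
    using assms ne[OF *(1)] by (intro arg_min_if_finite) auto
  then show "d (?v i) (?v (Suc i)) \<le> d (?v i) x"
    using * by (force simp: atLeast0AtMost)
qed

lemma L_NUV_eq:
  "L_NUV V E len v0 =
    (let d = graph_dist V E len; v = nuv_vertex V d v0 in \<Sum>i<card V - 1. d (v i) (v (Suc i)))"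
proof -
  have "(\<Sum>i = 1..k. f (i - 1) i) = (\<Sum>i<k. f i (Suc i))" for f :: "nat \<Rightarrow> nat \<Rightarrow> real" and k
    by (induction k) auto
  then show ?thesis unfolding L_NUV_def Let_def .
qed

text \<open>When the walk leaves the starting point of a long step, the starting points of all later
  steps are still unvisited, hence far away.\<close>

lemma card_long_steps_le:
  fixes V :: "'v set" and d v0
  defines "v \<equiv> nuv_vertex V d v0"
  assumes fin: "finite V" and v0: "v0 \<in> V" and NV: "\<And>x. x \<in> V \<Longrightarrow> N x \<subseteq> V"
    and close: "\<And>x y. x \<in> V \<Longrightarrow> y \<in> V \<Longrightarrow> N x \<inter> N y \<noteq> {} \<Longrightarrow> d x y \<le> r"
    and m: "m > 0"
  shows "real (card {i. i < card V - 1 \<and> d (v i) (v (Suc i)) > r}) \<le>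
    card V / m + card {x \<in> V. card (N x) < m}"
proof -
  define I where "I = {i. i < card V - 1 \<and> d (v i) (v (Suc i)) > r}"
  \<comment> \<open>Long steps whose starting point has a large neighbourhood. These neighbourhoods
    are disjoint subsets of \<open>V\<close> with at least \<open>m\<close> elements each, so at
    most \<open>card V / m\<close> of them fit.\<close>
  define I2 where "I2 = {i \<in> I. \<not> card (N (v i)) < m}"
  have finI: "finite I" "finite I2" unfolding I_def I2_def by auto
  have v: "v i \<in> V - v ` {..<i}" if "i < card V" for i
    unfolding v_def by (rule nuv_vertex_props(1)[OF fin v0 that])
  have vV: "v i \<in> V" if "i \<in> I" for i using v[of i] that by (auto simp: I_def)
  have cV: "i < card V" if "i \<in> I" for i using that by (auto simp: I_def)
  have far: "d (v i) (v j) > r" if "i \<in> I" "j \<in> I" "i < j" for i j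
  proof -
    have "v j \<in> V - v ` {..<j}" using v[of j] cV that by blast
    moreover have "v ` {..i} \<subseteq> v ` {..<j}" using that by auto
    ultimately have "d (v i) (v (Suc i)) \<le> d (v i) (v j)"
      unfolding v_def using that(1)
      by (intro nuv_vertex_props(2)[OF fin v0]) (auto simp: I_def)
    with that(1) show ?thesis by (simp add: I_def)
  qed
  have "inj_on v I"
  proof (rule linorder_inj_onI')
    fix i j assume "i \<in> I" "j \<in> I" "i < j"
    then have "v j \<notin> v ` {..<j}" "v i \<in> v ` {..<j}" using v[OF cV[of j]] by auto
    then show "v i \<noteq> v j" by metis
  qed
  have "N (v i) \<inter> N (v j) = {}" if "i \<in> I" "j \<in> I" "i < j" for i j
    using far[OF that] close[of "v i" "v j"] vV that by fastforce
  then have disj: "\<forall>i\<in>I2. \<forall>j\<in>I2. i \<noteq> j \<longrightarrow> N (v i) \<inter> N (v j) = {}"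
    unfolding I2_def by (metis (no_types, lifting) inf_commute linorder_neqE_nat mem_Collect_eq)
  have "card I2 * m \<le> (\<Sum>i\<in>I2. card (N (v i)))"
    by (rule sum_bounded_below[where 'a = nat, simplified]) (auto simp: I2_def)
  also have "\<dots> = card (\<Union>i\<in>I2. N (v i))"
    using disj finI finite_subset[OF NV[OF vV] fin]
    by (intro card_UN_disjoint[symmetric]) (auto simp: I2_def)
  also have "\<dots> \<le> card V"
    using NV vV fin by (intro card_mono) (auto simp: I2_def)
  finally have 1: "real (card I2) \<le> card V / m"
    using m by (simp add: field_simps flip: of_nat_mult)
  \<comment> \<open>The other long steps start at distinct vertices, because the walk chooses only
    unvisited ones, so the vertices with a small neighbourhood bound their number.\<close>
  have "card (I - I2) = card (v ` (I - I2))"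
    using \<open>inj_on v I\<close> by (intro card_image[symmetric]) (auto intro: inj_on_subset)
  also have "\<dots> \<le> card {x \<in> V. card (N x) < m}"
    using fin vV by (intro card_mono) (auto simp: I2_def)
  finally have 2: "card (I - I2) \<le> card {x \<in> V. card (N x) < m}" .
  have "card I = card I2 + card (I - I2)"
    using finI card_Diff_subset[of I2 I] card_mono[of I I2] by (auto simp: I2_def)
  with 1 2 show ?thesis unfolding I_def by linarith
qed

text \<open>If \<open>s\<close> lies between \<open>a * 2 ^ i\<close> and
  \<open>a * 2 ^ (i + 1)\<close> with \<open>i < J\<close>, the indicators with
  \<open>j \<le> i\<close> equal one, and \<open>a\<close> plus their geometric sum is exactly the
  upper endpoint. Above the last threshold the a priori bound \<open>D\<close> takes over. Summed
  over the steps of a walk, the indicators become counts of long steps.\<close>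

lemma dyadic_bound:
  fixes a s D :: real
  assumes "0 \<le> a" "s \<le> D" "0 \<le> D"
  shows "s \<le> a + (\<Sum>j<J. a * 2 ^ j * of_bool (s > a * 2 ^ j)) + D * of_bool (s > a * 2 ^ J)"
proof (cases "s > a * 2 ^ J")
  case True
  then show ?thesis using assms by (auto intro!: add_increasing sum_nonneg)
next
  case False
  then have "s \<le> a + (\<Sum>j<J. a * 2 ^ j * of_bool (s > a * 2 ^ j))"
  proof (induction J)
    case (Suc J)
    show ?case
    proof (cases "s > a * 2 ^ J")
      case True
      have "s > a * 2 ^ j" if "j \<le> J" for j
      proof -
        have "a * 2 ^ j \<le> a * 2 ^ J" using assms that by (intro mult_left_mono) auto
        then show ?thesis using True by simp
      qed
      then have "(\<Sum>j<Suc J. a * 2 ^ j * of_bool (s > a * 2 ^ j)) = (\<Sum>j<Suc J. a * 2 ^ j)"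
        by (intro sum.cong) auto
      also have "\<dots> = a * 2 ^ Suc J - a"
        by (induction J) (auto simp: algebra_simps)
      finally show ?thesis using Suc.prems by simp
    next
      case False
      with Suc.IH show ?thesis using assms by (auto intro!: add_increasing2)
    qed
  qed auto
  then show ?thesis using assms by (auto intro!: add_increasing2)
qed

subsection \<open>Measurability\<close>

text \<open>The choice among ties is a fixed function of the set \<open>A \<omega>\<close> of
  minimisers. This set takes finitely many values, each on a measurable event, and every function on
  a discrete space is measurable.\<close>

lemma measurable_arg_min_on:
  fixes f :: "'v \<Rightarrow> 'a \<Rightarrow> real"
  assumes "finite S" and [measurable]: "\<And>x. f x \<in> borel_measurable M"
  shows "(\<lambda>\<omega>. arg_min_on (\<lambda>x. f x \<omega>) S) \<in> measurable M (count_space UNIV)"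
proof -
  define A where "A \<omega> = {x \<in> S. \<forall>y\<in>S. \<not> f y \<omega> < f x \<omega>}" for \<omega>
  have "A \<in> measurable M (count_space (Pow S))"
    unfolding measurable_count_space_eq2[OF finite_Pow_iff[THEN iffD2, OF assms(1)]]
  proof safe
    fix B assume "B \<subseteq> S"
    then have "A -` {B} \<inter> space M =
        {\<omega> \<in> space M. \<forall>x\<in>S. (\<forall>y\<in>S. \<not> f y \<omega> < f x \<omega>) \<longleftrightarrow> x \<in> B}"
      by (intro set_eqI) (simp add: A_def set_eq_iff subset_iff, metis)
    also have "\<dots> \<in> sets M"
      unfolding pred_def[symmetric]
      by (intro pred_intros_finite(3) pred_intros_logic assms(1)) measurable
    finally show "A -` {B} \<inter> space M \<in> sets M" .
  qed (auto simp: A_def)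
  then have "(\<lambda>\<omega>. SOME x. x \<in> A \<omega>) \<in> measurable M (count_space UNIV)"
    by (rule measurable_compose) simp
  moreover have "x \<in> A \<omega> \<longleftrightarrow> is_arg_min (\<lambda>x. f x \<omega>) (\<lambda>x. x \<in> S) x" for x \<omega>
    by (auto simp: A_def is_arg_min_def)
  ultimately show ?thesis by (simp only: arg_min_on_def arg_min_def)
qed

text \<open>The next vertex depends on the whole history, so the induction runs over the list of
  vertices visited so far. Such lists form a countable type, which reduces the claim to one fixed
  list at a time.\<close>

lemma measurable_nuv_vertex:
  fixes d :: "'a \<Rightarrow> 'v :: countable \<Rightarrow> 'v \<Rightarrow> real"
  assumes "finite V" and d: "\<And>u v. (\<lambda>\<omega>. d \<omega> u v) \<in> borel_measurable M"
  shows "(\<lambda>\<omega>. nuv_vertex V (d \<omega>) v0 i) \<in> measurable M (count_space UNIV)"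
proof -
  have "(\<lambda>\<omega>. map (nuv_vertex V (d \<omega>) v0) [0..<Suc i]) \<in> measurable M (count_space UNIV)"
  proof (induction i)
    case (Suc i)
    let ?F = "\<lambda>l \<omega>. l @ [arg_min_on (d \<omega> (last l)) (V - set l)]"
    have "(\<lambda>\<omega>. arg_min_on (d \<omega> (last l)) (V - set l)) \<in> measurable M (count_space UNIV)" for l
      using assms by (intro measurable_arg_min_on) auto
    then have "?F l \<in> measurable M (count_space UNIV)" for l
      by (rule measurable_compose) simp
    from measurable_compose_countable[OF this Suc.IH]
    have "(\<lambda>\<omega>. ?F (map (nuv_vertex V (d \<omega>) v0) [0..<Suc i]) \<omega>) \<in> measurable M (count_space UNIV)" .
    also have "(\<lambda>\<omega>. ?F (map (nuv_vertex V (d \<omega>) v0) [0..<Suc i]) \<omega>) =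
        (\<lambda>\<omega>. map (nuv_vertex V (d \<omega>) v0) [0..<Suc (Suc i)])"
    proof
      fix \<omega>
      let ?v = "nuv_vertex V (d \<omega>) v0"
      have "set (map ?v [0..<Suc i]) = ?v ` {0..i}" "last (map ?v [0..<Suc i]) = ?v i"
        by (auto simp del: nuv_vertex.simps upt_Suc simp: last_map)
      then have "?F (map ?v [0..<Suc i]) \<omega> = map ?v [0..<Suc i] @ [?v (Suc i)]"
        by (simp only: nuv_vertex.simps)
      then show "?F (map ?v [0..<Suc i]) \<omega> = map ?v [0..<Suc (Suc i)]"
        by (simp del: nuv_vertex.simps)
    qed
    finally show ?case .
  qed simp
  from measurable_compose[OF this, of last] show ?thesis by simp
qed

lemma measurable_L_NUV:
  fixes len :: "'v :: countable set \<Rightarrow> 'a \<Rightarrow> real"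
  assumes "finite V" and len: "\<And>e. e \<in> E \<Longrightarrow> len e \<in> borel_measurable M"
  shows "(\<lambda>\<omega>. L_NUV V E (\<lambda>e. len e \<omega>) v0) \<in> borel_measurable M"
proof -
  have [measurable]: "(\<lambda>\<omega>. graph_dist V E (\<lambda>e. len e \<omega>) u v) \<in> borel_measurable M" for u v
    unfolding graph_dist_def
  proof (rule borel_measurable_Min)
    show "finite {xs. is_path V E u v xs}"
      by (rule finite_paths[OF assms(1), where len = "\<lambda>_. 0"]) auto
  next
    fix xs assume "xs \<in> {xs. is_path V E u v xs}"
    then show "(\<lambda>\<omega>. path_length (\<lambda>e. len e \<omega>) xs) \<in> borel_measurable M"
      unfolding path_length_def by (intro borel_measurable_sum len) (auto simp: is_path_def)
  qed
  let ?d = "\<lambda>\<omega>. graph_dist V E (\<lambda>e. len e \<omega>)"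
  let ?v = "\<lambda>i \<omega>. nuv_vertex V (?d \<omega>) v0 i"
  have v: "?v i \<in> measurable M (count_space UNIV)" for i
    by (rule measurable_nuv_vertex[OF assms(1)]) measurable
  \<comment> \<open>Both arguments of the distance are random vertices; countability of the vertex
    type allows them to be fixed one after the other.\<close>
  have "(\<lambda>\<omega>. ?d \<omega> u (?v j \<omega>)) \<in> borel_measurable M" for u j
    by (rule measurable_compose_countable[OF _ v, where f = "\<lambda>w \<omega>. ?d \<omega> u w"]) measurable
  then have "(\<lambda>\<omega>. ?d \<omega> (?v i \<omega>) (?v j \<omega>)) \<in> borel_measurable M" for i j
    by (rule measurable_compose_countable[OF _ v, where f = "\<lambda>u \<omega>. ?d \<omega> u (?v j \<omega>)"])
  then show ?thesis
    unfolding L_NUV_eq Let_def by (intro borel_measurable_sum)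
qed

subsection \<open>Random graphs with independent edges\<close>

lemma doubleton_in_nsets_iff: "{x, y} \<in> nsets V 2 \<longleftrightarrow> x \<in> V \<and> y \<in> V \<and> x \<noteq> y"
  by (cases "x = y") (simp_all add: nsets_def)

text \<open>The predicate \<open>c\<close> tells which edges are open.\<close>

definition nbr2 :: "'v set \<Rightarrow> ('v set \<Rightarrow> bool) \<Rightarrow> 'v \<Rightarrow> 'v set" where
  "nbr2 V c v = {u \<in> V. u \<noteq> v \<and> (\<exists>w\<in>V. w \<noteq> v \<and> w \<noteq> u \<and> c {v, w} \<and> c {w, u})}"

lemma nbr2_cong:
  assumes "v \<in> V" "\<And>e. e \<in> nsets V 2 \<Longrightarrow> c e = c' e"
  shows "nbr2 V c v = nbr2 V c' v"
proof -
  have "c {x, y} = c' {x, y}" if "x \<in> V" "y \<in> V" "x \<noteq> y" for x y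
    using assms(2) that by (simp add: doubleton_in_nsets_iff)
  with assms(1) show ?thesis unfolding nbr2_def by auto
qed

context prob_space
begin

text \<open>Each block \<open>K j\<close> is finite, so its product sigma-algebra is discrete and
  \<open>h j\<close> is automatically measurable. \<open>h j\<close> takes a configuration of all
  edges but may read only those in \<open>K j\<close>, so that applications need no restricted
  functions.\<close>

lemma indep_vars_groups:
  fixes B :: "'e \<Rightarrow> 'a \<Rightarrow> bool" and h :: "'j \<Rightarrow> ('e \<Rightarrow> bool) \<Rightarrow> bool"
  assumes "indep_vars (\<lambda>_. count_space UNIV) B E" "disjoint_family_on K L"
    and K: "\<And>j. j \<in> L \<Longrightarrow> K j \<subseteq> E" "\<And>j. j \<in> L \<Longrightarrow> finite (K j)"
    and h: "\<And>j c c'. j \<in> L \<Longrightarrow> (\<And>e. e \<in> K j \<Longrightarrow> c e = c' e) \<Longrightarrow> h j c = h j c'"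
  shows "indep_vars (\<lambda>_. count_space UNIV) (\<lambda>j \<omega>. h j (\<lambda>e. B e \<omega>)) L"
proof -
  have "indep_vars (\<lambda>_. count_space UNIV) (\<lambda>j \<omega>. h j (\<lambda>e\<in>K j. B e \<omega>)) L"
    by (rule indep_vars_compose2[OF indep_vars_restrict[OF assms(1) K(1) assms(2)]])
      (simp_all add: count_space_PiM_finite K(2))
  moreover have "h j (\<lambda>e\<in>K j. B e \<omega>) = h j (\<lambda>e. B e \<omega>)" if "j \<in> L" for j \<omega>
    using that by (intro h) auto
  ultimately show ?thesis
    by (subst indep_vars_cong[OF refl _ refl]) (auto simp: fun_eq_iff)
qed

text \<open>The case of a single block: independence of a family includes measurability of its
  members.\<close>

lemma pred_config:
  fixes B :: "'e \<Rightarrow> 'a \<Rightarrow> bool" and h :: "('e \<Rightarrow> bool) \<Rightarrow> bool"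
  assumes "indep_vars (\<lambda>_. count_space UNIV) B E" "finite E"
    and "\<And>c c'. (\<And>e. e \<in> E \<Longrightarrow> c e = c' e) \<Longrightarrow> h c = h c'"
  shows "Measurable.pred M (\<lambda>\<omega>. h (\<lambda>e. B e \<omega>))"
proof -
  have "indep_vars (\<lambda>_. count_space UNIV) (\<lambda>_ \<omega>. h (\<lambda>e. B e \<omega>)) {()}"
    by (rule indep_vars_groups[OF assms(1), where K = "\<lambda>_. E"])
      (simp_all add: disjoint_family_on_def assms(2), rule assms(3))
  then show ?thesis by (simp add: indep_vars_def)
qed

text \<open>The value \<open>b\<close> is a parameter because both cases occur below: all edges
  closed and all edges open.\<close>

lemma prob_all_indep:
  fixes B :: "'e \<Rightarrow> 'a \<Rightarrow> bool"
  assumes ind: "indep_vars (\<lambda>_. count_space UNIV) B F" "finite F"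
    and p: "\<And>e. e \<in> F \<Longrightarrow> prob {\<omega> \<in> space M. B e \<omega> = b} = p"
  shows "prob {\<omega> \<in> space M. \<forall>e\<in>F. B e \<omega> = b} = p ^ card F"
proof (cases "F = {}")
  case False
  have vim: "B e -` {b} \<inter> space M = {\<omega> \<in> space M. B e \<omega> = b}" for e by auto
  have "prob (\<Inter>e\<in>F. B e -` {b} \<inter> space M) = (\<Prod>e\<in>F. prob (B e -` {b} \<inter> space M))"
    using False by (intro indep_varsD_finite[OF ind(1)] ind) auto
  also have "\<dots> = p ^ card F" by (simp add: p vim)
  also have "(\<Inter>e\<in>F. B e -` {b} \<inter> space M) = {\<omega> \<in> space M. \<forall>e\<in>F. B e \<omega> = b}"
    using False by auto
  finally show ?thesis .
qed (simp add: prob_space)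

text \<open>Exponential Markov inequality for \<open>2\<close> to the power minus the number of successes.\<close>

lemma prob_few_successes_le:
  fixes Z :: "'j \<Rightarrow> 'a \<Rightarrow> bool"
  assumes ind: "indep_vars (\<lambda>_. count_space UNIV) Z (insert c L)" and L: "finite L" "c \<notin> L"
    and \<rho>: "\<And>j. j \<in> L \<Longrightarrow> \<rho> \<le> prob {\<omega> \<in> space M. Z j \<omega>}"
  shows "prob {\<omega> \<in> space M. Z c \<omega> \<and> card {j \<in> L. Z j \<omega>} < m} \<le>
    prob {\<omega> \<in> space M. Z c \<omega>} * (2 ^ m * (1 - \<rho> / 2) ^ card L)"
proof -
  \<comment> \<open>The factor at \<open>c\<close> is the indicator of a side event independent of
    the successes, and each success in \<open>L\<close> contributes 1/2. Multiplied by
    \<open>2 ^ m\<close>, the product of all factors is at least 1 on the event to be bounded, and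
    its expectation factorises.\<close>
  define g :: "'j \<Rightarrow> bool \<Rightarrow> real" where
    "g j z = (if j = c then of_bool z else if z then 1 / 2 else 1)" for j z
  have Z [measurable]: "Measurable.pred M (Z j)" if "j \<in> insert c L" for j
    using ind that by (auto simp: indep_vars_def)
  have ind_g: "indep_vars (\<lambda>_. borel) (\<lambda>j \<omega>. g j (Z j \<omega>)) (insert c L)"
    by (rule indep_vars_compose2[OF ind]) simp
  have int: "integrable M (\<lambda>\<omega>. g j (Z j \<omega>))" if "j \<in> insert c L" for j
  proof (rule integrable_const_bound[where B = 1])
    show "(\<lambda>\<omega>. g j (Z j \<omega>)) \<in> borel_measurable M"
      using Z[OF that] by (rule measurable_compose) simp
  qed (auto simp: g_def)
  have prod: "(\<Prod>j\<in>insert c L. g j (Z j \<omega>)) = of_bool (Z c \<omega>) * (1 / 2) ^ card {j \<in> L. Z j \<omega>}" for \<omega>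
  proof -
    have "(\<Prod>j\<in>L. g j (Z j \<omega>)) = (\<Prod>j\<in>L. if Z j \<omega> then 1 / 2 else 1)"
      using L by (intro prod.cong) (auto simp: g_def)
    also have "\<dots> = (1 / 2) ^ card {j \<in> L. Z j \<omega>}"
      using L by (simp add: prod.If_cases Int_def)
    finally show ?thesis using L by (simp add: g_def)
  qed
  have Eg_c: "expectation (\<lambda>\<omega>. g c (Z c \<omega>)) = prob {\<omega> \<in> space M. Z c \<omega>}"
  proof -
    have "expectation (\<lambda>\<omega>. g c (Z c \<omega>)) = expectation (indicator {\<omega> \<in> space M. Z c \<omega>})"
      by (rule Bochner_Integration.integral_cong) (auto simp: g_def indicator_def)
    then show ?thesis using Z[of c] by simp
  qed
  have Eg: "0 \<le> expectation (\<lambda>\<omega>. g j (Z j \<omega>))" "expectation (\<lambda>\<omega>. g j (Z j \<omega>)) \<le> 1 - \<rho> / 2"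
    if j: "j \<in> L" for j
  proof -
    show "0 \<le> expectation (\<lambda>\<omega>. g j (Z j \<omega>))"
      by (rule Bochner_Integration.integral_nonneg) (auto simp: g_def)
    have [measurable]: "Measurable.pred M (Z j)" using Z j by blast
    have "expectation (\<lambda>\<omega>. g j (Z j \<omega>)) =
        expectation (\<lambda>\<omega>. 1 - indicator {\<omega> \<in> space M. Z j \<omega>} \<omega> / 2)"
      using j L by (intro Bochner_Integration.integral_cong) (auto simp: g_def indicator_def)
    also have "\<dots> = 1 - prob {\<omega> \<in> space M. Z j \<omega>} / 2"
      by (subst Bochner_Integration.integral_diff)
        (auto simp: prob_space less_top[symmetric] intro!: integrable_divide integrable_real_indicator)
    finally show "expectation (\<lambda>\<omega>. g j (Z j \<omega>)) \<le> 1 - \<rho> / 2" using \<rho>[OF j] by simp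
  qed
  have int_prod: "integrable M (\<lambda>\<omega>. 2 ^ m * (\<Prod>j\<in>insert c L. g j (Z j \<omega>)))"
    by (rule integrable_mult_right, rule indep_vars_integrable[OF _ ind_g int]) (use L in auto)
  have [measurable]: "Measurable.pred M (Z c)" "Measurable.pred M (\<lambda>\<omega>. card {j \<in> L. Z j \<omega>} < m)"
  proof -
    have "real (card {j \<in> L. Z j \<omega>}) = (\<Sum>j\<in>L. of_bool (Z j \<omega>))" for \<omega>
      using L by (simp add: Int_def)
    then have "(card {j \<in> L. Z j \<omega>} < m) = ((\<Sum>j\<in>L. of_bool (Z j \<omega>)) < real m)" for \<omega>
      by (metis of_nat_less_iff)
    moreover have "(\<lambda>\<omega>. \<Sum>j\<in>L. of_bool (Z j \<omega>) :: real) \<in> borel_measurable M"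
      by (intro borel_measurable_sum measurable_compose[OF Z]) auto
    ultimately show "Measurable.pred M (\<lambda>\<omega>. card {j \<in> L. Z j \<omega>} < m)" by simp
  qed (use Z in auto)
  let ?A = "{\<omega> \<in> space M. Z c \<omega> \<and> card {j \<in> L. Z j \<omega>} < m}"
  have "prob ?A = expectation (indicator ?A)" by simp
  also have "\<dots> \<le> expectation (\<lambda>\<omega>. 2 ^ m * (\<Prod>j\<in>insert c L. g j (Z j \<omega>)))"
  proof (rule integral_mono[OF _ int_prod])
    fix \<omega>
    have "(1 / 2 :: real) ^ m \<le> (1 / 2) ^ card {j \<in> L. Z j \<omega>}" if "card {j \<in> L. Z j \<omega>} < m"
      using that by (intro power_decreasing) auto
    then have "1 \<le> (2 ^ m :: real) * (1 / 2) ^ card {j \<in> L. Z j \<omega>}" if "card {j \<in> L. Z j \<omega>} < m"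
      using that by (simp add: field_simps)
    then show "indicator ?A \<omega> \<le> 2 ^ m * (\<Prod>j\<in>insert c L. g j (Z j \<omega>))"
      unfolding prod by (auto simp: indicator_def)
  qed (auto intro!: integrable_real_indicator simp: less_top[symmetric])
  also have "\<dots> = 2 ^ m * (\<Prod>j\<in>insert c L. expectation (\<lambda>\<omega>. g j (Z j \<omega>)))"
    unfolding integral_mult_right_zero
    using indep_vars_lebesgue_integral[OF _ ind_g int] L by simp
  also have "\<dots> = prob {\<omega> \<in> space M. Z c \<omega>} * (2 ^ m * (\<Prod>j\<in>L. expectation (\<lambda>\<omega>. g j (Z j \<omega>))))"
    using L Eg_c by simp
  also have "\<dots> \<le> prob {\<omega> \<in> space M. Z c \<omega>} * (2 ^ m * (\<Prod>j\<in>L. 1 - \<rho> / 2))"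
    using Eg by (intro mult_left_mono prod_mono) auto
  finally show ?thesis by simp
qed

text \<open>Condition on the set \<open>S\<close> of neighbours of \<open>v\<close> and keep only \<open>k\<close> of them, \<open>T S\<close>: the edges
  between \<open>T S\<close> and the other vertices are independent of \<open>S\<close>, and the events that a vertex is
  joined to \<open>T S\<close> are independent of each other.\<close>

lemma prob_nbr2_small_le:
  fixes B :: "'v set \<Rightarrow> 'a \<Rightarrow> bool" and k m :: nat
  assumes V: "finite V" "v \<in> V" and p01: "0 \<le> p" "p \<le> 1"
    and ind: "indep_vars (\<lambda>_. count_space UNIV) B (nsets V 2)"
    and p: "\<And>e. e \<in> nsets V 2 \<Longrightarrow> prob {\<omega> \<in> space M. B e \<omega>} = p"
  defines "\<rho> \<equiv> 1 - (1 - p) ^ k"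
  shows "prob {\<omega> \<in> space M. card (nbr2 V (\<lambda>e. B e \<omega>) v) < m} \<le>
    2 ^ k * (1 - p / 2) ^ (card V - 1) + 2 ^ m * (1 - \<rho> / 2) ^ (card V - 1 - k)"
proof -
  define U where "U = V - {v}"
  have U: "finite U" "card U = card V - 1" "v \<notin> U" "U \<subseteq> V" using V by (auto simp: U_def)
  define S where "S \<omega> = {w \<in> U. B {v, w} \<omega>}" for \<omega>
  \<comment> \<open>The choice depends on the set \<open>A\<close> alone, so it is deterministic
    once \<open>S \<omega> = A\<close> is fixed.\<close>
  define T where "T A = (SOME T. T \<subseteq> A \<and> card T = k)" for A :: "'v set"
  have T: "T A \<subseteq> A" "card (T A) = k" if "k \<le> card A" for A
  proof -
    have "\<exists>T. T \<subseteq> A \<and> card T = k" using obtain_subset_with_card_n[OF that] by metis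
    from someI_ex[OF this] show "T A \<subseteq> A" "card (T A) = k" by (auto simp: T_def)
  qed
  define Y where "Y A \<omega> = card {u \<in> U - T A. \<exists>w\<in>T A. B {w, u} \<omega>}" for A \<omega>
  define \<A> where "\<A> = {A \<in> Pow U. k \<le> card A}"
  define b where "b = 2 ^ m * (1 - \<rho> / 2) ^ (card V - 1 - k)"
  have fin: "finite \<A>" using U by (simp add: \<A>_def)
  note ind_sub = indep_vars_subset[OF ind]

  \<comment> \<open>\<open>prob_few_successes_le\<close> expects a side event at an index outside
    \<open>U\<close>. Here it is the sure event, placed at \<open>v\<close> with an empty block of
    edges.\<close>
  have "prob {\<omega> \<in> space M. True \<and> card {w \<in> U. B {v, w} \<omega>} < k} \<le>
      prob {\<omega> \<in> space M. True} * (2 ^ k * (1 - p / 2) ^ card U)"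
  proof -
    define K where "K w = (if w = v then {} else {{v, w}})" for w
    define h where "h w c = (if w = v then True else c {v, w})" for w and c :: "'v set \<Rightarrow> bool"
    have "indep_vars (\<lambda>_. count_space UNIV) (\<lambda>w \<omega>. h w (\<lambda>e. B e \<omega>)) (insert v U)"
      by (rule indep_vars_groups[OF ind, where K = K])
        (use U V in \<open>auto simp: K_def h_def disjoint_family_on_def doubleton_eq_iff
          doubleton_in_nsets_iff U_def\<close>)
    moreover have "p \<le> prob {\<omega> \<in> space M. h w (\<lambda>e. B e \<omega>)}" if "w \<in> U" for w
      using p[of "{v, w}"] that V by (auto simp: h_def U_def doubleton_in_nsets_iff)
    ultimately have "prob {\<omega> \<in> space M. h v (\<lambda>e. B e \<omega>) \<and> card {w \<in> U. h w (\<lambda>e. B e \<omega>)} < k} \<le>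
        prob {\<omega> \<in> space M. h v (\<lambda>e. B e \<omega>)} * (2 ^ k * (1 - p / 2) ^ card U)"
      by (intro prob_few_successes_le U(1,3))
    moreover have "{w \<in> U. h w (\<lambda>e. B e \<omega>)} = {w \<in> U. B {v, w} \<omega>}" for \<omega>
      using U by (auto simp: h_def)
    moreover have "h v c = True" for c by (simp add: h_def)
    ultimately show ?thesis by (simp only:)
  qed
  then have few: "prob {\<omega> \<in> space M. card (S \<omega>) < k} \<le> 2 ^ k * (1 - p / 2) ^ (card V - 1)"
    by (simp add: S_def prob_space U)

  have cond: "prob {\<omega> \<in> space M. S \<omega> = A \<and> Y A \<omega> < m} \<le> prob {\<omega> \<in> space M. S \<omega> = A} * b"
    if A: "A \<in> \<A>" for A
  proof -
    have TA: "T A \<subseteq> U" "card (T A) = k" using T[of A] A by (auto simp: \<A>_def)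
    then have vT: "v \<notin> T A" and finT: "finite (T A)" using U finite_subset by auto
    \<comment> \<open>The side event at \<open>v\<close> is \<open>S \<omega> = A\<close>, which
      reads the edges from \<open>v\<close> to \<open>U\<close>; a vertex \<open>u\<close> of
      \<open>U - T A\<close> reads its edges to \<open>T A\<close>. The latter avoid
      \<open>v\<close>, and \<open>u\<close> is their only end outside \<open>T A\<close>, so the
      blocks are disjoint.\<close>
    define K where "K u = (if u = v then (\<lambda>w. {v, w}) ` U else (\<lambda>w. {w, u}) ` T A)" for u
    define h where "h u c = (if u = v then {w \<in> U. c {v, w}} = A else \<exists>w\<in>T A. c {w, u})"
      for u and c :: "'v set \<Rightarrow> bool"
    have disj: "disjoint_family_on K (insert v (U - T A))"
      using vT U by (auto simp: disjoint_family_on_def K_def doubleton_eq_iff)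
    have "indep_vars (\<lambda>_. count_space UNIV) (\<lambda>u \<omega>. h u (\<lambda>e. B e \<omega>)) (insert v (U - T A))"
    proof (rule indep_vars_groups[OF ind disj])
      fix u and c c' :: "'v set \<Rightarrow> bool"
      assume "u \<in> insert v (U - T A)" "\<And>e. e \<in> K u \<Longrightarrow> c e = c' e"
      then have "u = v \<Longrightarrow> {w \<in> U. c {v, w}} = {w \<in> U. c' {v, w}}"
        "u \<noteq> v \<Longrightarrow> w \<in> T A \<Longrightarrow> c {w, u} = c' {w, u}" for w
        by (auto simp: K_def)
      then show "h u c = h u c'" by (auto simp: h_def)
    next
      fix u assume "u \<in> insert v (U - T A)"
      then show "K u \<subseteq> nsets V 2"
        using TA(1) V by (auto simp: K_def doubleton_in_nsets_iff U_def)
      show "finite (K u)" using finT U by (simp add: K_def)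
    qed
    moreover have "\<rho> \<le> prob {\<omega> \<in> space M. h u (\<lambda>e. B e \<omega>)}" if u: "u \<in> U - T A" for u
    proof -
      let ?F = "(\<lambda>w. {w, u}) ` T A"
      have F: "?F \<subseteq> nsets V 2" using TA(1) u by (auto simp: doubleton_in_nsets_iff U_def)
      have inj: "inj_on (\<lambda>w. {w, u}) (T A)" by (auto simp: inj_on_def doubleton_eq_iff)
      have B: "{\<omega> \<in> space M. B e \<omega>} \<in> events" if "e \<in> nsets V 2" for e
        using ind that by (auto simp: indep_vars_def)
      \<comment> \<open>The \<open>k\<close> edges from \<open>u\<close> to \<open>T A\<close> are
        all closed with probability \<open>(1 - p) ^ k\<close>, so \<open>\<rho>\<close> is exactly
        the probability that \<open>u\<close> is joined to \<open>T A\<close>.\<close>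
      have "prob {\<omega> \<in> space M. \<forall>e\<in>?F. B e \<omega> = False} = (1 - p) ^ card ?F"
      proof (rule prob_all_indep[OF ind_sub[OF F]])
        fix e assume "e \<in> ?F"
        then show "prob {\<omega> \<in> space M. B e \<omega> = False} = 1 - p"
          using prob_neg[OF B[of e]] p[of e] F by auto
      qed (use finT in auto)
      also have "card ?F = k" using card_image[OF inj] TA by simp
      finally have none: "prob {\<omega> \<in> space M. \<forall>w\<in>T A. \<not> B {w, u} \<omega>} = (1 - p) ^ k" by simp
      have "{\<omega> \<in> space M. \<exists>w\<in>T A. B {w, u} \<omega>} \<in> events"
        using F by (intro sets.sets_Collect_finite_Ex finT B) blast
      from prob_neg[OF this] none
      have "\<rho> = prob {\<omega> \<in> space M. \<exists>w\<in>T A. B {w, u} \<omega>}" by (simp add: \<rho>_def)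
      also have "h u c \<longleftrightarrow> (\<exists>w\<in>T A. c {w, u})" for c using u U by (auto simp: h_def)
      then have "prob {\<omega> \<in> space M. \<exists>w\<in>T A. B {w, u} \<omega>} =
        prob {\<omega> \<in> space M. h u (\<lambda>e. B e \<omega>)}" by simp
      finally show ?thesis by simp
    qed
    ultimately have "prob {\<omega> \<in> space M. h v (\<lambda>e. B e \<omega>) \<and>
        card {u \<in> U - T A. h u (\<lambda>e. B e \<omega>)} < m} \<le>
        prob {\<omega> \<in> space M. h v (\<lambda>e. B e \<omega>)} * (2 ^ m * (1 - \<rho> / 2) ^ card (U - T A))"
      using U by (intro prob_few_successes_le) auto
    moreover have "card (U - T A) = card V - 1 - k"
      using TA U finT by (simp add: card_Diff_subset)
    moreover have "h v (\<lambda>e. B e \<omega>) \<longleftrightarrow> S \<omega> = A" for \<omega> by (simp add: h_def S_def)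
    moreover have "{u \<in> U - T A. h u (\<lambda>e. B e \<omega>)} = {u \<in> U - T A. \<exists>w\<in>T A. B {w, u} \<omega>}" for \<omega>
      using U by (auto simp: h_def)
    ultimately show ?thesis by (simp add: b_def Y_def)
  qed

  have fin_nsets: "finite (nsets V 2)" using V by (simp add: finite_imp_finite_nsets)
  have in_nsets: "{v, w} \<in> nsets V 2" if "w \<in> U" for w
    using that V by (auto simp: U_def doubleton_in_nsets_iff)
  have meas_S [measurable]: "Measurable.pred M (\<lambda>\<omega>. P (S \<omega>))" for P
    unfolding S_def
  proof (rule pred_config[OF ind fin_nsets, where h = "\<lambda>c. P {w \<in> U. c {v, w}}"])
    fix c c' :: "'v set \<Rightarrow> bool" assume "\<And>e. e \<in> nsets V 2 \<Longrightarrow> c e = c' e"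
    then have "c {v, w} = c' {v, w}" if "w \<in> U" for w using in_nsets that by simp
    then have "{w \<in> U. c {v, w}} = {w \<in> U. c' {v, w}}" by auto
    then show "P {w \<in> U. c {v, w}} = P {w \<in> U. c' {v, w}}" by simp
  qed
  have meas_Y: "Measurable.pred M (\<lambda>\<omega>. S \<omega> = A \<and> Y A \<omega> < m)" if A: "A \<in> \<A>" for A
  proof -
    have e: "{w, u} \<in> nsets V 2" if "w \<in> T A" "u \<in> U - T A" for w u
      using that T[of A] A by (auto simp: \<A>_def U_def doubleton_in_nsets_iff)
    show ?thesis
      unfolding S_def Y_def
    proof (rule pred_config[OF ind fin_nsets, where h = "\<lambda>c. {w \<in> U. c {v, w}} = A \<and>
        card {u \<in> U - T A. \<exists>w\<in>T A. c {w, u}} < m"])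
      fix c c' :: "'v set \<Rightarrow> bool" assume "\<And>e. e \<in> nsets V 2 \<Longrightarrow> c e = c' e"
      then have "w \<in> U \<Longrightarrow> c {v, w} = c' {v, w}"
        "w \<in> T A \<Longrightarrow> u \<in> U - T A \<Longrightarrow> c {w, u} = c' {w, u}" for w u
        using e in_nsets by auto
      then have "{w \<in> U. c {v, w}} = {w \<in> U. c' {v, w}}"
        "{u \<in> U - T A. \<exists>w\<in>T A. c {w, u}} = {u \<in> U - T A. \<exists>w\<in>T A. c' {w, u}}"
        by auto
      then show "({w \<in> U. c {v, w}} = A \<and> card {u \<in> U - T A. \<exists>w\<in>T A. c {w, u}} < m) =
        ({w \<in> U. c' {v, w}} = A \<and> card {u \<in> U - T A. \<exists>w\<in>T A. c' {w, u}} < m)"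
        by simp
    qed
  qed
  let ?few = "{\<omega> \<in> space M. card (S \<omega>) < k}"
  let ?E = "\<lambda>A. {\<omega> \<in> space M. S \<omega> = A \<and> Y A \<omega> < m}"
  have "0 \<le> (1 - p) ^ k" using p01 by simp
  then have "0 \<le> b" by (simp add: b_def \<rho>_def field_simps)
  \<comment> \<open>If \<open>v\<close> has at least \<open>k\<close> neighbours, take
    \<open>A = S \<omega>\<close>: every vertex counted by \<open>Y A \<omega>\<close> is reached
    from \<open>v\<close> through an element of \<open>T A\<close>, so \<open>Y A \<omega>\<close>
    is at most the size of the second neighbourhood.\<close>
  have "{\<omega> \<in> space M. card (nbr2 V (\<lambda>e. B e \<omega>) v) < m} \<subseteq> ?few \<union> (\<Union>A\<in>\<A>. ?E A)"
  proof safe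
    fix \<omega> assume \<omega>: "\<omega> \<in> space M" "card (nbr2 V (\<lambda>e. B e \<omega>) v) < m"
      "\<omega> \<notin> (\<Union>A\<in>\<A>. ?E A)"
    show "card (S \<omega>) < k"
    proof (rule ccontr)
      assume "\<not> card (S \<omega>) < k"
      then have k: "k \<le> card (S \<omega>)" and S: "S \<omega> \<in> \<A>" by (auto simp: \<A>_def S_def)
      have "{u \<in> U - T (S \<omega>). \<exists>w\<in>T (S \<omega>). B {w, u} \<omega>} \<subseteq> nbr2 V (\<lambda>e. B e \<omega>) v"
        using T(1)[OF k] by (auto simp: S_def nbr2_def U_def)
      then have "Y (S \<omega>) \<omega> \<le> card (nbr2 V (\<lambda>e. B e \<omega>) v)"
        unfolding Y_def by (rule card_mono[rotated]) (use V in \<open>simp add: nbr2_def\<close>)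
      with \<omega> S show False by auto
    qed
  qed
  then have "prob {\<omega> \<in> space M. card (nbr2 V (\<lambda>e. B e \<omega>) v) < m} \<le> prob (?few \<union> (\<Union>A\<in>\<A>. ?E A))"
    using meas_Y fin by (intro finite_measure_mono sets.Un sets.finite_UN) auto
  also have "\<dots> \<le> prob ?few + prob (\<Union>A\<in>\<A>. ?E A)"
    using meas_Y fin by (intro measure_Un_le sets.finite_UN) auto
  also have "prob (\<Union>A\<in>\<A>. ?E A) \<le> (\<Sum>A\<in>\<A>. prob (?E A))"
    using meas_Y fin by (intro finite_measure_subadditive_finite) auto
  also have "\<dots> \<le> (\<Sum>A\<in>\<A>. prob {\<omega> \<in> space M. S \<omega> = A} * b)"
    by (intro sum_mono cond)
  \<comment> \<open>The events \<open>S \<omega> = A\<close> are disjoint, so the conditional bounds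
    add up to at most \<open>b\<close>.\<close>
  also have "\<dots> = prob (\<Union>A\<in>\<A>. {\<omega> \<in> space M. S \<omega> = A}) * b"
    by (subst finite_measure_finite_Union[OF fin])
      (auto simp: sum_distrib_right disjoint_family_on_def)
  also have "\<dots> \<le> 1 * b" by (intro mult_right_mono prob_le_1 \<open>0 \<le> b\<close>)
  finally show ?thesis using few by (simp add: b_def)
qed

end

subsection \<open>The mean-field model\<close>

text \<open>Follows from \<open>(1 - x / 2) * (1 + x) \<ge> 1\<close> on the unit interval. It
  bounds the probability of an edge of length at most \<open>t \<le> n\<close> below by a linear
  function of \<open>t\<close>.\<close>

lemma one_minus_exp_ge_half:
  fixes x :: real
  assumes "0 \<le> x" "x \<le> 1"
  shows "x / 2 \<le> 1 - exp (- x)"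
proof -
  have "(1 - x / 2) * (1 + x) = 1 + x * (1 - x) / 2" by (simp add: field_simps)
  then have "1 / (1 + x) \<le> 1 - x / 2"
    using assms by (simp add: pos_divide_le_eq)
  moreover have "exp (- x) \<le> 1 / (1 + x)"
    using assms exp_ge_add_one_self[of x] by (simp add: exp_minus inverse_eq_divide frac_le)
  ultimately show ?thesis by simp
qed

text \<open>Combines \<open>1 - x \<le> exp (- x)\<close> with \<open>2 \<le> exp 1\<close>. In the
  application \<open>x\<close> is half a success probability, \<open>b\<close> the number of trials
  and \<open>a\<close> the threshold for the number of successes.\<close>

lemma two_power_mult_one_minus_power_le:
  fixes x :: real
  assumes "0 \<le> x" "x \<le> 1" "2 * real a \<le> x * real b"
  shows "2 ^ a * (1 - x) ^ b \<le> exp (- real a)"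
proof -
  have "(1 - x) ^ b \<le> exp (- x) ^ b"
    using exp_ge_add_one_self[of "- x"] assms by (intro power_mono) auto
  also have "\<dots> = exp (- (x * b))" by (simp add: exp_of_nat_mult[symmetric] mult.commute)
  also have "\<dots> \<le> exp (- (2 * real a))" using assms by simp
  finally have 1: "(1 - x) ^ b \<le> exp (- (2 * real a))" .
  have "(2 :: real) ^ a \<le> exp 1 ^ a"
    using exp_ge_add_one_self[of 1] by (intro power_mono) auto
  also have "\<dots> = exp (real a)" by (simp add: exp_of_nat_mult[symmetric])
  finally have "2 ^ a * (1 - x) ^ b \<le> exp (real a) * exp (- (2 * real a))"
    using 1 assms by (intro mult_mono) auto
  then show ?thesis by (simp flip: exp_add)
qed

section \<open>Short edges, second neighbourhoods and diameter\<close>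

text \<open>Two edges through \<open>w\<close>, or four edges \<open>x\<close>, \<open>w\<close>,
  \<open>u\<close>, \<open>w'\<close>, \<open>y\<close> through a common element \<open>u\<close> of
  both neighbourhoods. Adding them one at a time with \<open>graph_dist_step\<close> avoids
  requiring the intermediate vertices to be distinct.\<close>

lemma complete_graph_dist_nbr2_le:
  fixes len :: "'v set \<Rightarrow> real"
  assumes V: "finite V" "x \<in> V" "y \<in> V"
    and nonneg: "\<And>e. e \<in> nsets V 2 \<Longrightarrow> 0 \<le> len e"
  shows "x \<noteq> y \<Longrightarrow> w \<in> V - {x, y} \<Longrightarrow> len {x, w} \<le> t \<Longrightarrow> len {w, y} \<le> t \<Longrightarrow>
      graph_dist V (nsets V 2) len x y \<le> 2 * t"
    and "nbr2 V (\<lambda>e. len e \<le> t) x \<inter> nbr2 V (\<lambda>e. len e \<le> t) y \<noteq> {} \<Longrightarrow>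
      graph_dist V (nsets V 2) len x y \<le> 4 * t"
proof -
  let ?d = "graph_dist V (nsets V 2) len"
  have path: "\<exists>xs. is_path V (nsets V 2) u v xs" if "u \<in> V" "v \<in> V" for u v
  proof (cases "u = v")
    case True
    then show ?thesis using that by (intro exI[of _ "[u]"]) simp
  next
    case False
    then show ?thesis using that
      by (intro exI[of _ "[u, v]"]) (simp add: is_path_Cons2 doubleton_in_nsets_iff)
  qed
  have step: "?d u z \<le> t + ?d v z"
    if "u \<in> V" "v \<in> V" "z \<in> V" "u \<noteq> v" "len {u, v} \<le> t" for u v z
  proof -
    from path[OF that(2,3)] obtain xs where "is_path V (nsets V 2) v z xs" by blast
    from graph_dist_step[OF V(1), of "nsets V 2" len, OF nonneg _ that(1) this] that show ?thesis
      by (simp add: doubleton_in_nsets_iff)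
  qed
  have refl: "?d y y \<le> 0" using graph_dist_refl[OF V(1), of "nsets V 2" len, OF nonneg V(3)] .
  show "?d x y \<le> 2 * t" if "x \<noteq> y" "w \<in> V - {x, y}" "len {x, w} \<le> t" "len {w, y} \<le> t"
    using step[of x w y] step[of w y y] that V refl by auto
  show "?d x y \<le> 4 * t" if "nbr2 V (\<lambda>e. len e \<le> t) x \<inter> nbr2 V (\<lambda>e. len e \<le> t) y \<noteq> {}"
  proof -
    from that obtain u where u: "u \<in> nbr2 V (\<lambda>e. len e \<le> t) x" "u \<in> nbr2 V (\<lambda>e. len e \<le> t) y"
      by blast
    from u(1) obtain w where
      w: "u \<in> V" "w \<in> V" "x \<noteq> w" "w \<noteq> u" "len {x, w} \<le> t" "len {w, u} \<le> t"
      by (auto simp: nbr2_def)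
    from u(2) obtain w' where
      w': "w' \<in> V" "w' \<noteq> y" "u \<noteq> w'" "len {w', y} \<le> t" "len {u, w'} \<le> t"
      by (auto simp: nbr2_def insert_commute)
    note step[OF V(2) w(2) V(3) w(3,5)] step[OF w(2,1) V(3) w(4,6)]
      step[OF w(1) w'(1) V(3) w'(3,5)] step[OF w'(1) V(3) V(3) w'(2,4)]
    with refl show ?thesis by linarith
  qed
qed

lemma bernoulli_of_mean_field_model:
  assumes mf: "mean_field_model n M len" and n: "n \<ge> 2" and t: "0 \<le> t"
  shows "prob_space.indep_vars M (\<lambda>_. count_space UNIV) (\<lambda>e \<omega>. len e \<omega> \<le> t) (nsets {..<n} 2)"
    and "\<And>e. e \<in> nsets {..<n} 2 \<Longrightarrow>
      measure M {\<omega> \<in> space M. len e \<omega> \<le> t} = 1 - exp (- (t / real n))"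
proof -
  interpret prob_space M using mf by (simp add: mean_field_model_def)
  show "indep_vars (\<lambda>_. count_space UNIV) (\<lambda>e \<omega>. len e \<omega> \<le> t) (nsets {..<n} 2)"
    by (rule indep_vars_compose2[where M' = "\<lambda>_. borel"])
      (use mf in \<open>auto simp: mean_field_model_def complete_edges_def\<close>)
  fix e assume "e \<in> nsets {..<n} 2"
  then have "distributed M lborel (len e) (exponential_density (1 / real n))"
    using mf by (auto simp: mean_field_model_def complete_edges_def)
  from exponential_distributedD_le[OF this t] n
  show "prob {\<omega> \<in> space M. len e \<omega> \<le> t} = 1 - exp (- (t / real n))" by simp
qed

text \<open>The threshold \<open>32 * k\<close> gives \<open>p \<ge> 16 * k / n\<close> and
  \<open>\<rho> \<ge> 8 * k\<^sup>2 / n\<close>. At least \<open>n / 2\<close> trials remain at each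
  level, so \<open>two_power_mult_one_minus_power_le\<close> applies with \<open>a = k\<close> and
  with \<open>a = k\<^sup>2\<close>, and both terms of \<open>prob_nbr2_small_le\<close> are at most
  \<open>exp (- k)\<close>.\<close>

lemma prob_nbr2_small_mean_field_le:
  assumes mf: "mean_field_model n M len" and n: "n \<ge> 64" "16 * k\<^sup>2 \<le> n" and k: "k \<ge> 1"
    and v: "v < n"
  shows "measure M {\<omega> \<in> space M. card (nbr2 {..<n} (\<lambda>e. len e \<omega> \<le> 32 * real k) v) < k\<^sup>2}
    \<le> 4 / (real k)\<^sup>2"
proof -
  interpret prob_space M using mf by (simp add: mean_field_model_def)
  define p where "p = 1 - exp (- (32 * real k / n))"
  define \<rho> where "\<rho> = 1 - (1 - p) ^ k"
  have kn: "16 * (real k)\<^sup>2 \<le> n"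
    using of_nat_mono[OF n(2), where 'a = real] by simp
  have "real k \<le> (real k)\<^sup>2" using k by (intro self_le_power) auto
  then have k16: "16 * real k \<le> n" using kn by linarith
  \<comment> \<open>Squaring leads back to \<open>16 * k\<^sup>2 \<le> n\<close>; the remaining
    factor 64 is at most \<open>n\<close>.\<close>
  have "(32 * real k)\<^sup>2 \<le> (real n)\<^sup>2"
  proof -
    have "(32 * real k)\<^sup>2 = 64 * (16 * (real k)\<^sup>2)" by (simp add: power_mult_distrib)
    also have "\<dots> \<le> real n * real n" using kn n(1) by (intro mult_mono) auto
    finally show ?thesis by (simp add: power2_eq_square)
  qed
  then have k32: "32 * real k \<le> n" by (rule power2_le_imp_le) simp
  have p01: "0 \<le> p" "p \<le> 1" by (auto simp: p_def)
  have p: "16 * real k / real n \<le> p"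
    using one_minus_exp_ge_half[of "32 * real k / real n"] k32 n(1) by (simp add: p_def)
  have "(1 - p) ^ k = exp (- (32 * (real k)\<^sup>2 / n))"
    by (simp add: p_def exp_of_nat_mult[symmetric] power2_eq_square)
  \<comment> \<open>\<open>one_minus_exp_ge_half\<close> needs an argument of at most 1, which the
    hypothesis provides for \<open>16 * k\<^sup>2 / n\<close> but not for twice that.\<close>
  moreover have "exp (- (32 * (real k)\<^sup>2 / n)) \<le> exp (- (16 * (real k)\<^sup>2 / n))"
    by (simp add: divide_right_mono)
  moreover have "8 * (real k)\<^sup>2 / n \<le> 1 - exp (- (16 * (real k)\<^sup>2 / n))"
    using one_minus_exp_ge_half[of "16 * (real k)\<^sup>2 / n"] kn n(1) by simp
  ultimately have \<rho>: "8 * (real k)\<^sup>2 / n \<le> \<rho>" unfolding \<rho>_def by linarith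
  have \<rho>01: "0 \<le> \<rho>" "\<rho> \<le> 1" using p01 by (auto simp: \<rho>_def power_le_one)

  have "2 ^ k * (1 - p / 2) ^ (n - 1) \<le> exp (- real k)"
  proof (rule two_power_mult_one_minus_power_le)
    have "2 * real k \<le> 4 * real k" by simp
    also have "\<dots> = 16 * real k / real n / 2 * (real n / 2)" using n(1) by (simp add: field_simps)
    also have "\<dots> \<le> p / 2 * real (n - 1)"
      using p n(1) p01 by (intro mult_mono divide_right_mono) auto
    finally show "2 * real k \<le> p / 2 * real (n - 1)" .
  qed (use p01 in auto)
  moreover have "2 ^ k\<^sup>2 * (1 - \<rho> / 2) ^ (n - 1 - k) \<le> exp (- real (k\<^sup>2))"
  proof (rule two_power_mult_one_minus_power_le)
    have "real n / 2 \<le> real (n - 1 - k)" using n(1) k16 by linarith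
    then have "8 * (real k)\<^sup>2 / real n / 2 * (real n / 2) \<le> \<rho> / 2 * real (n - 1 - k)"
      using \<rho> \<rho>01 by (intro mult_mono divide_right_mono) auto
    moreover have "8 * (real k)\<^sup>2 / real n / 2 * (real n / 2) = 2 * real (k\<^sup>2)"
      using n(1) by (simp add: field_simps)
    ultimately show "2 * real (k\<^sup>2) \<le> \<rho> / 2 * real (n - 1 - k)" by simp
  qed (use \<rho>01 in auto)
  moreover have "exp (- real (k\<^sup>2)) \<le> exp (- real k)"
    using k by (simp add: power2_eq_square flip: of_nat_mult)
  \<comment> \<open>The polynomial form is what gets summed over dyadic \<open>k\<close> later; the
    two terms together give \<open>4 / k\<^sup>2\<close>.\<close>
  moreover have "exp (- real k) \<le> 2 / (real k)\<^sup>2"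
  proof -
    have "(real k)\<^sup>2 / 2 \<le> exp (real k)" using exp_lower_Taylor_quadratic[of "real k"] by simp
    then have "inverse (exp (real k)) \<le> inverse ((real k)\<^sup>2 / 2)"
      using k by (intro le_imp_inverse_le) auto
    then show ?thesis by (simp add: exp_minus)
  qed
  moreover have "prob {\<omega> \<in> space M. card (nbr2 {..<n} (\<lambda>e. len e \<omega> \<le> 32 * real k) v) < k\<^sup>2} \<le>
      2 ^ k * (1 - p / 2) ^ (n - 1) + 2 ^ k\<^sup>2 * (1 - \<rho> / 2) ^ (n - 1 - k)"
    using prob_nbr2_small_le[where V = "{..<n}" and v = v and p = p and k = k and m = "k\<^sup>2"
        and B = "\<lambda>e \<omega>. len e \<omega> \<le> 32 * real k"] v p01
      bernoulli_of_mean_field_model[OF mf, of "32 * real k"] n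
    by (simp add: p_def \<rho>_def)
  ultimately show ?thesis by linarith
qed

text \<open>For fixed \<open>u\<close> and \<open>v\<close>, the \<open>n - 2\<close> connections
  through a third vertex use disjoint pairs of edges, and each is open with probability
  \<open>(1 - exp (- 1))\<^sup>2 \<ge> 1 / 4\<close>. Having fewer than one success then costs at
  most \<open>2 * (7 / 8) ^ (n - 2)\<close>, and a union bound over at most \<open>n\<^sup>2\<close>
  ordered pairs finishes.\<close>

lemma prob_diam_large_mean_field_le:
  assumes mf: "mean_field_model n M len" and n: "n \<ge> 2"
  shows "{\<omega> \<in> space M. \<exists>u<n. \<exists>v<n. u \<noteq> v \<and>
      \<not> (\<exists>w\<in>{..<n} - {u, v}. len {u, w} \<omega> \<le> n \<and> len {w, v} \<omega> \<le> n)} \<in> sets M" (is "?D \<in> _")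
    and "measure M {\<omega> \<in> space M. \<exists>u<n. \<exists>v<n. u \<noteq> v \<and>
      \<not> (\<exists>w\<in>{..<n} - {u, v}. len {u, w} \<omega> \<le> n \<and> len {w, v} \<omega> \<le> n)}
      \<le> 2 * (real n)\<^sup>2 * (7 / 8) ^ (n - 2)"
proof -
  interpret prob_space M using mf by (simp add: mean_field_model_def)
  let ?B = "\<lambda>e \<omega>. len e \<omega> \<le> real n"
  define D where "D x = {\<omega> \<in> space M. \<not> (\<exists>w\<in>{..<n} - {fst x, snd x}.
    ?B {fst x, w} \<omega> \<and> ?B {w, snd x} \<omega>)}" for x
  define P where "P = {(u, v). u < n \<and> v < n \<and> u \<noteq> v}"
  have P: "P \<subseteq> {..<n} \<times> {..<n}" by (auto simp: P_def)
  then have finP: "finite P" by (rule finite_subset) simp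
  have "card P \<le> card ({..<n} \<times> {..<n})" using P by (intro card_mono) auto
  then have cardP: "card P \<le> n\<^sup>2" by (simp add: power2_eq_square)
  note ind = bernoulli_of_mean_field_model(1)[OF mf n, of "real n", simplified]
  have p: "prob {\<omega> \<in> space M. ?B e \<omega>} = 1 - exp (- 1)" if "e \<in> nsets {..<n} 2" for e
    using bernoulli_of_mean_field_model(2)[OF mf n _ that, of "real n"] n by simp
  have ev [measurable]: "Measurable.pred M (?B e)" if "e \<in> nsets {..<n} 2" for e
    using ind that by (auto simp: indep_vars_def)
  have ex_P: "(\<exists>u<n. \<exists>v<n. u \<noteq> v \<and> Q u v) \<longleftrightarrow> (\<exists>x\<in>P. Q (fst x) (snd x))" for Q
    by (force simp: P_def)
  have D_eq: "?D = (\<Union>x\<in>P. D x)"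
    unfolding D_def ex_P by blast
  have D_pair: "D (u, v) \<in> events \<and> prob (D (u, v)) \<le> 2 * (7 / 8) ^ (n - 2)"
    if "(u, v) \<in> P" for u v
  proof -
    have uv: "u < n" "v < n" "u \<noteq> v" using that by (auto simp: P_def)
    let ?L = "{..<n} - {u, v}"
    \<comment> \<open>The index \<open>u\<close> carries the sure event as side event. The blocks
      are disjoint because \<open>w\<close> is the only vertex outside \<open>{u, v}\<close> on its
      two edges.\<close>
    define K where "K w = (if w = u then {} else {{u, w}, {w, v}})" for w
    define h where "h w c = (if w = u then True else c {u, w} \<and> c {w, v})"
      for w and c :: "nat set \<Rightarrow> bool"
    have "indep_vars (\<lambda>_. count_space UNIV) (\<lambda>w \<omega>. h w (\<lambda>e. ?B e \<omega>)) (insert u ?L)"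
    proof (rule indep_vars_groups[OF ind])
      show "disjoint_family_on K (insert u ?L)"
        using uv by (auto simp: disjoint_family_on_def K_def doubleton_eq_iff)
      show "K j \<subseteq> nsets {..<n} 2" if "j \<in> insert u ?L" for j
        using uv that by (auto simp: K_def doubleton_in_nsets_iff)
      show "finite (K j)" for j by (simp add: K_def)
      show "h j c = h j c'" if "\<And>e. e \<in> K j \<Longrightarrow> c e = c' e" for j c c'
        using that by (auto simp: h_def K_def split: if_splits)
    qed
    moreover have "1 / 4 \<le> prob {\<omega> \<in> space M. h w (\<lambda>e. ?B e \<omega>)}" if w: "w \<in> ?L" for w
    proof -
      have F: "{{u, w}, {w, v}} \<subseteq> nsets {..<n} 2" using uv w by (auto simp: doubleton_in_nsets_iff)
      have "prob {\<omega> \<in> space M. \<forall>e\<in>{{u, w}, {w, v}}. ?B e \<omega> = True} =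
          (1 - exp (- 1)) ^ card {{u, w}, {w, v}}"
      proof (rule prob_all_indep[OF indep_vars_subset[OF ind F]])
        fix e assume "e \<in> {{u, w}, {w, v}}"
        with F have "e \<in> nsets {..<n} 2" by blast
        then show "prob {\<omega> \<in> space M. ?B e \<omega> = True} = 1 - exp (- 1)" using p by simp
      qed simp
      moreover have "card {{u, w}, {w, v}} = 2" using uv w by (auto simp: doubleton_eq_iff)
      moreover have "{\<omega> \<in> space M. h w (\<lambda>e. ?B e \<omega>)} =
          {\<omega> \<in> space M. \<forall>e\<in>{{u, w}, {w, v}}. ?B e \<omega> = True}"
        using w by (auto simp: h_def)
      moreover have "(1 / 2)\<^sup>2 \<le> (1 - exp (- 1) :: real)\<^sup>2"
        using one_minus_exp_ge_half[of 1] by (intro power_mono) auto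
      ultimately show ?thesis by (simp add: power2_eq_square)
    qed
    ultimately have "prob {\<omega> \<in> space M. h u (\<lambda>e. ?B e \<omega>) \<and> card {w \<in> ?L. h w (\<lambda>e. ?B e \<omega>)} < 1}
        \<le> prob {\<omega> \<in> space M. h u (\<lambda>e. ?B e \<omega>)} * (2 ^ 1 * (1 - 1 / 4 / 2) ^ card ?L)"
      by (intro prob_few_successes_le) auto
    moreover have "{w \<in> ?L. h w (\<lambda>e. ?B e \<omega>)} = {w \<in> ?L. ?B {u, w} \<omega> \<and> ?B {w, v} \<omega>}" for \<omega>
      by (auto simp: h_def)
    moreover have "h u c = True" for c by (simp add: h_def)
    moreover have "card ?L = n - 2" using uv by (simp add: card_Diff_subset)
    ultimately have "prob {\<omega> \<in> space M. True \<and> card {w \<in> ?L. ?B {u, w} \<omega> \<and> ?B {w, v} \<omega>} < 1}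
        \<le> prob {\<omega> \<in> space M. True} * (2 ^ 1 * (1 - 1 / 4 / 2) ^ (n - 2))"
      by (simp only:)
    moreover have D_uv: "D (u, v) = {\<omega> \<in> space M. \<forall>w\<in>?L. \<not> (?B {u, w} \<omega> \<and> ?B {w, v} \<omega>)}"
      unfolding D_def by simp
    moreover have "card {w \<in> ?L. Q w} < 1 \<longleftrightarrow> (\<forall>w\<in>?L. \<not> Q w)" for Q
      by (auto simp: card_eq_0_iff)
    ultimately have "prob (D (u, v)) \<le> 2 * (7 / 8) ^ (n - 2)"
      by (simp only: simp_thms) (simp add: prob_space)
    moreover have "D (u, v) \<in> events"
      unfolding D_uv
    proof (rule sets.sets_Collect_finite_All)
      fix w assume w: "w \<in> ?L"
      have "{u, w} \<in> nsets {..<n} 2" "{w, v} \<in> nsets {..<n} 2"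
        using uv w by (auto simp: doubleton_in_nsets_iff)
      then show "{\<omega> \<in> space M. \<not> (?B {u, w} \<omega> \<and> ?B {w, v} \<omega>)} \<in> events"
        by (intro sets.sets_Collect_neg sets.sets_Collect_conj ev[unfolded pred_def])
    qed simp
    ultimately show ?thesis by simp
  qed
  then show "?D \<in> events" unfolding D_eq using finP by (intro sets.finite_UN) auto
  have "prob ?D \<le> (\<Sum>x\<in>P. prob (D x))"
    unfolding D_eq using finP D_pair by (intro finite_measure_subadditive_finite) auto
  also have "\<dots> \<le> (\<Sum>x\<in>P. 2 * (7 / 8) ^ (n - 2))"
    using D_pair by (intro sum_mono) auto
  also have "\<dots> \<le> (real n)\<^sup>2 * (2 * (7 / 8) ^ (n - 2))"
    using cardP by (auto intro!: mult_right_mono simp flip: of_nat_power)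
  finally show "prob ?D \<le> 2 * (real n)\<^sup>2 * (7 / 8) ^ (n - 2)" by (simp add: mult_ac)
qed

section \<open>From counts of long steps to the length of the walk\<close>

text \<open>Sums \<open>dyadic_bound\<close> over the steps and exchanges the order of summation, so
  that each indicator turns into a number of long steps.\<close>

lemma L_NUV_le_dyadic:
  fixes V :: "'v set" and E len v0
  defines "d \<equiv> graph_dist V E len"
  defines "v \<equiv> nuv_vertex V d v0"
  assumes V: "finite V" "v0 \<in> V" and "0 \<le> a" "0 \<le> D"
    and D: "\<And>x y. x \<in> V \<Longrightarrow> y \<in> V \<Longrightarrow> d x y \<le> D"
    and C: "\<And>j. j \<le> J \<Longrightarrow> real (card {i. i < card V - 1 \<and> d (v i) (v (Suc i)) > a * 2 ^ j}) \<le> C j"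
  shows "L_NUV V E len v0 \<le> a * card V + (\<Sum>j<J. a * 2 ^ j * C j) + D * C J"
proof -
  define s where "s i = d (v i) (v (Suc i))" for i
  let ?I = "{..<card V - 1}"
  have C': "(\<Sum>i\<in>?I. of_bool (s i > a * 2 ^ j)) \<le> C j" if "j \<le> J" for j
  proof -
    have "(\<Sum>i\<in>?I. of_bool (s i > a * 2 ^ j)) = real (card (?I \<inter> {i. s i > a * 2 ^ j}))"
      by simp
    also have "?I \<inter> {i. s i > a * 2 ^ j} = {i. i < card V - 1 \<and> s i > a * 2 ^ j}" by auto
    finally show ?thesis using C[OF that] by (simp add: s_def)
  qed
  have vV: "v i \<in> V" if "i < card V" for i
    using nuv_vertex_props(1)[OF V that, of d] by (simp add: v_def)
  have "L_NUV V E len v0 = (\<Sum>i\<in>?I. s i)"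
    by (simp add: L_NUV_eq Let_def s_def v_def d_def del: nuv_vertex.simps)
  also have "\<dots> \<le> (\<Sum>i\<in>?I. a + (\<Sum>j<J. a * 2 ^ j * of_bool (s i > a * 2 ^ j)) +
      D * of_bool (s i > a * 2 ^ J))"
    using assms(5,6) vV by (intro sum_mono dyadic_bound) (auto simp: s_def intro!: D)
  also have "\<dots> = a * real (card V - 1) +
      (\<Sum>j<J. a * 2 ^ j * (\<Sum>i\<in>?I. of_bool (s i > a * 2 ^ j))) +
      D * (\<Sum>i\<in>?I. of_bool (s i > a * 2 ^ J))"
    unfolding sum.distrib sum_distrib_left
    by (subst sum.swap) simp
  also have "\<dots> \<le> a * card V + (\<Sum>j<J. a * 2 ^ j * C j) + D * C J"
    using assms(5,6) by (intro add_mono mult_left_mono sum_mono C') auto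
  finally show ?thesis .
qed

text \<open>Outside the event \<open>Bad\<close> of large diameter and a null set, the length is at
  most a random variable \<open>X\<close> of expectation at most \<open>2048 * n\<close>. Markov's
  inequality for \<open>X\<close> gives the first term, the probability of \<open>Bad\<close> the
  second.\<close>

lemma prob_L_NUV_gt_le:
  assumes mf: "mean_field_model n M len" and n: "n \<ge> 64" and v0: "v0 < n" and K: "K > 0"
  shows "measure M {\<omega> \<in> space M.
      \<bar>L_NUV {..<n} (complete_edges n) (\<lambda>e. len e \<omega>) v0 / real n\<bar> > K}
    \<le> 2048 / K + 2 * (real n)\<^sup>2 * (7 / 8) ^ (n - 2)"
proof -
  interpret prob_space M using mf by (simp add: mean_field_model_def)
  let ?V = "{..<n}" and ?E = "nsets {..<n} 2"
  have n2: "n \<ge> 2" using n by simp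
  define L where "L \<omega> = L_NUV ?V ?E (\<lambda>e. len e \<omega>) v0" for \<omega>
  define Bad where "Bad = {\<omega> \<in> space M. \<exists>u<n. \<exists>v<n. u \<noteq> v \<and>
    \<not> (\<exists>w\<in>{..<n} - {u, v}. len {u, w} \<omega> \<le> n \<and> len {w, v} \<omega> \<le> n)}"
  note Bad = prob_diam_large_mean_field_le[OF mf n2, folded Bad_def]
  have dist: "distributed M lborel (len e) (exponential_density (1 / real n))" if "e \<in> ?E" for e
    using mf that by (auto simp: mean_field_model_def complete_edges_def)
  have len [measurable]: "len e \<in> borel_measurable M" if "e \<in> ?E" for e
    using distributed_measurable[OF dist[OF that]] by simp
  \<comment> \<open>Exponential lengths are nonnegative only almost surely, whereas the distance
    lemmas ask for nonnegative lengths at the given \<open>\<omega>\<close>.\<close>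
  have AE_nonneg: "AE \<omega> in M. \<forall>e\<in>?E. 0 \<le> len e \<omega>"
  proof (rule AE_ball_countable')
    fix e assume e: "e \<in> ?E"
    have "prob {\<omega> \<in> space M. len e \<omega> \<le> 0} = 0"
      using exponential_distributedD_le[OF dist[OF e], of 0] n by simp
    then have "AE \<omega> in M. \<not> len e \<omega> \<le> 0"
      using len[OF e] by (subst (asm) prob_eq_0) auto
    then show "AE \<omega> in M. 0 \<le> len e \<omega>" by eventually_elim simp
  qed (simp add: countable_finite finite_imp_finite_nsets)

  define small where "small k v = {\<omega> \<in> space M.
    card (nbr2 ?V (\<lambda>e. len e \<omega> \<le> 32 * real k) v) < k\<^sup>2}" for k v
  \<comment> \<open>The bound of \<open>card_long_steps_le\<close> for \<open>m = k\<^sup>2\<close>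
    and \<open>r = 128 * k\<close>, as a random variable.\<close>
  define C where "C k \<omega> = real n / (real k)\<^sup>2 + (\<Sum>v<n. indicator (small k v) \<omega>)" for k \<omega>
  have small: "small k v \<in> events" if "v < n" for k v
    unfolding small_def pred_def[symmetric]
  proof (rule pred_config[OF bernoulli_of_mean_field_model(1)[OF mf n2],
        where h = "\<lambda>c. card (nbr2 ?V c v) < k\<^sup>2"])
    fix c c' :: "nat set \<Rightarrow> bool" assume "\<And>e. e \<in> ?E \<Longrightarrow> c e = c' e"
    then have "nbr2 ?V c v = nbr2 ?V c' v" using that by (intro nbr2_cong) auto
    then show "(card (nbr2 ?V c v) < k\<^sup>2) = (card (nbr2 ?V c' v) < k\<^sup>2)" by simp
  qed (auto simp: finite_imp_finite_nsets)
  have int_ind: "integrable M (indicator (small k v) :: _ \<Rightarrow> real)" if "v < n" for k v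
    using small[OF that] by (intro integrable_real_indicator) (auto simp: less_top[symmetric])
  have int_C: "integrable M (C k)" for k
    unfolding C_def by (intro Bochner_Integration.integrable_add integrable_const
        Bochner_Integration.integrable_sum int_ind) auto
  have E_C: "expectation (C k) \<le> 5 * real n / (real k)\<^sup>2" if "k \<ge> 1" "16 * k\<^sup>2 \<le> n" for k
  proof -
    have "expectation (C k) = real n / (real k)\<^sup>2 + (\<Sum>v<n. prob (small k v))"
      unfolding C_def using int_ind small
      by (subst Bochner_Integration.integral_add) (auto simp: prob_space Bochner_Integration.integral_sum)
    also have "(\<Sum>v<n. prob (small k v)) \<le> (\<Sum>v<n. 4 / (real k)\<^sup>2)"
      unfolding small_def using that n
      by (intro sum_mono prob_nbr2_small_mean_field_le[OF mf]) auto
    finally show ?thesis by (simp add: add_divide_distrib[symmetric])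
  qed

  have "1 \<le> n div 16" using n by simp
  \<comment> \<open>The largest \<open>J\<close> for which \<open>k = 2 ^ J\<close> satisfies
    \<open>16 * k\<^sup>2 \<le> n\<close>. Maximality gives \<open>n < 64 * 4 ^ J\<close>, so the
    expected number of steps above the last threshold is bounded by a constant.\<close>
  then obtain J where J: "4 ^ J \<le> n div 16" "n div 16 < 4 ^ (J + 1)"
    using ex_power_ivl1[of 4 "n div 16"] by auto
  have "16 * 4 ^ J \<le> n" "n < 64 * 4 ^ J" using J by auto
  then have nJ: "real n < 64 * 4 ^ J"
    by (metis of_nat_less_iff of_nat_mult of_nat_numeral of_nat_power)
  have sq: "((2::'b::comm_semiring_1) ^ j)\<^sup>2 = 4 ^ j" for j
    by (simp add: power2_eq_square flip: power_mult_distrib)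
  \<comment> \<open>The right-hand side of \<open>L_NUV_le_dyadic\<close> for \<open>a = 128\<close>
    and \<open>D = 2 * n\<close>: the thresholds are \<open>128 * k\<close> with
    \<open>k = 2 ^ j\<close>, and outside \<open>Bad\<close> all distances are at most
    \<open>2 * n\<close>.\<close>
  define X where "X \<omega> = 128 * real n + (\<Sum>j<J. 128 * 2 ^ j * C (2 ^ j) \<omega>) +
    2 * real n * C (2 ^ J) \<omega>" for \<omega>
  have int_X: "integrable M X"
    unfolding X_def by (intro Bochner_Integration.integrable_add integrable_const
        Bochner_Integration.integrable_sum integrable_mult_right int_C)
  have E_C2: "expectation (C (2 ^ j)) \<le> 5 * real n / 4 ^ j" if "j \<le> J" for j
  proof -
    have "(4::nat) ^ j \<le> 4 ^ J" using that by (intro power_increasing) auto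
    then have "16 * (2 ^ j)\<^sup>2 \<le> n" using \<open>16 * 4 ^ J \<le> n\<close> unfolding sq by linarith
    from E_C[OF _ this] show ?thesis by (simp add: sq)
  qed
  have E_X: "expectation X \<le> 2048 * real n"
  proof -
    have "expectation X = 128 * real n + (\<Sum>j<J. 128 * 2 ^ j * expectation (C (2 ^ j))) +
        2 * real n * expectation (C (2 ^ J))"
      unfolding X_def using int_C by (simp add: prob_space)
    also have "\<dots> \<le> 128 * real n + (\<Sum>j<J. 128 * 2 ^ j * (5 * real n / 4 ^ j)) +
        2 * real n * (5 * real n / 4 ^ J)"
      by (intro add_mono mult_left_mono sum_mono E_C2) auto
    also have "(\<Sum>j<J. 128 * 2 ^ j * (5 * real n / 4 ^ j)) = 640 * real n * (\<Sum>j<J. (1 / 2) ^ j)"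
    proof -
      have "128 * 2 ^ j * (5 * real n / 4 ^ j) = 640 * real n * (1 / 2 :: real) ^ j" for j
      proof -
        have "(1 / 2 :: real) ^ j = 2 ^ j / 4 ^ j" by (simp flip: power_divide)
        then show ?thesis by simp
      qed
      then show ?thesis by (simp only: sum_distrib_left)
    qed
    \<comment> \<open>The geometric sum is at most 2 and \<open>5 * n / 4 ^ J\<close> at most 320,
      so the constant is 128 + 1280 + 640 = 2048.\<close>
    also have "128 * real n + 640 * real n * (\<Sum>j<J. (1 / 2) ^ j) + 2 * real n * (5 * real n / 4 ^ J)
        \<le> 128 * real n + 640 * real n * 2 + 2 * real n * 320"
    proof (intro add_mono mult_left_mono)
      show "(\<Sum>j<J. (1 / 2 :: real) ^ j) \<le> 2" by (simp add: sum_gp_strict)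
      show "5 * real n / 4 ^ J \<le> 320" using nJ by (simp add: field_simps)
    qed auto
    finally show ?thesis by simp
  qed

  have le_X: "L \<omega> \<le> X \<omega> \<and> 0 \<le> L \<omega>"
    if \<omega>: "\<omega> \<in> space M" "\<forall>e\<in>?E. 0 \<le> len e \<omega>" "\<omega> \<notin> Bad" for \<omega>
  proof -
    let ?d = "graph_dist ?V ?E (\<lambda>e. len e \<omega>)"
    let ?v = "nuv_vertex ?V ?d v0"
    have nonneg: "0 \<le> len e \<omega>" if "e \<in> ?E" for e using \<omega>(2) that by blast
    have diam: "?d x y \<le> 2 * real n" if xy: "x \<in> ?V" "y \<in> ?V" for x y
    proof (cases "x = y")
      case True
      then show ?thesis
        using graph_dist_refl[of ?V ?E "\<lambda>e. len e \<omega>" x] nonneg xy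
        by (auto intro: order_trans)
    next
      case False
      then obtain w where "w \<in> ?V - {x, y}" "len {x, w} \<omega> \<le> n" "len {w, y} \<omega> \<le> n"
        using \<omega>(1,3) xy unfolding Bad_def by blast
      with False xy show ?thesis
        by (intro complete_graph_dist_nbr2_le(1)[where len = "\<lambda>e. len e \<omega>"] nonneg) auto
    qed
    have count: "real (card {i. i < card ?V - 1 \<and> ?d (?v i) (?v (Suc i)) > 128 * 2 ^ j}) \<le> C (2 ^ j) \<omega>" for j
    proof -
      let ?N = "nbr2 ?V (\<lambda>e. len e \<omega> \<le> 32 * 2 ^ j)"
      have "real (card {i. i < card ?V - 1 \<and> ?d (?v i) (?v (Suc i)) > 128 * 2 ^ j}) \<le>
          card ?V / ((2 ^ j)\<^sup>2 :: nat) + card {x \<in> ?V. card (?N x) < (2 ^ j)\<^sup>2}"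
      proof (rule card_long_steps_le)
        show "?N x \<subseteq> ?V" for x by (auto simp: nbr2_def)
        show "?d x y \<le> 128 * 2 ^ j" if "x \<in> ?V" "y \<in> ?V" "?N x \<inter> ?N y \<noteq> {}" for x y
          using complete_graph_dist_nbr2_le(2)[OF _ that(1,2) nonneg that(3)] by simp
      qed (use v0 in auto)
      also have "real (card {x \<in> ?V. card (?N x) < (2 ^ j)\<^sup>2}) = (\<Sum>v<n. indicator (small (2 ^ j) v) \<omega>)"
        using \<omega>(1) by (simp add: small_def indicator_def Int_def)
      finally show ?thesis by (simp add: C_def)
    qed
    have "L \<omega> \<le> X \<omega>"
      using L_NUV_le_dyadic[of ?V v0 128 "2 * real n" ?E "\<lambda>e. len e \<omega>" J "\<lambda>j. C (2 ^ j) \<omega>"]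
        v0 diam count
      by (simp add: L_def X_def)
    moreover have "0 \<le> L \<omega>"
    proof -
      have v: "?v i \<in> ?V - ?v ` {..<i}" if "i < n" for i
        using nuv_vertex_props(1)[of ?V v0 i ?d] that v0 by simp
      have "0 \<le> ?d (?v i) (?v (Suc i))" if "i < n - 1" for i
      proof (rule graph_dist_nonneg)
        have "?v i \<in> ?V" "?v (Suc i) \<in> ?V" "?v i \<noteq> ?v (Suc i)"
          using v[of i] v[of "Suc i"] less_diff_conv[of i n 1] that
          by (auto simp: lessThan_Suc simp del: nuv_vertex.simps)
        then show "is_path ?V ?E (?v i) (?v (Suc i)) [?v i, ?v (Suc i)]"
          by (simp add: is_path_Cons2 doubleton_in_nsets_iff del: nuv_vertex.simps)
      qed (use nonneg in auto)
      then show ?thesis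
        unfolding L_def L_NUV_eq Let_def by (intro sum_nonneg) (simp del: nuv_vertex.simps)
    qed
    ultimately show ?thesis ..
  qed

  let ?T = "{\<omega> \<in> space M. X \<omega> \<ge> K * real n}"
  have [measurable]: "X \<in> borel_measurable M" using int_X by (rule borel_measurable_integrable)
  have T: "?T \<in> events" by measurable
  have "prob {\<omega> \<in> space M. \<bar>L \<omega> / n\<bar> > K} \<le> prob (?T \<union> Bad)"
  proof (rule finite_measure_mono_AE)
    \<comment> \<open>The null set on which some length is negative is discarded here, since
      \<open>le_X\<close> says nothing there.\<close>
    show "AE \<omega> in M. \<omega> \<in> {\<omega> \<in> space M. \<bar>L \<omega> / n\<bar> > K} \<longrightarrow> \<omega> \<in> ?T \<union> Bad"
      using AE_nonneg
    proof (rule AE_mp, intro AE_I2 impI)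
      fix \<omega> assume \<omega>: "\<omega> \<in> space M" "\<forall>e\<in>?E. 0 \<le> len e \<omega>" "\<omega> \<in> {\<omega> \<in> space M. \<bar>L \<omega> / n\<bar> > K}"
      show "\<omega> \<in> ?T \<union> Bad"
      proof (cases "\<omega> \<in> Bad")
        case False
        from le_X[OF \<omega>(1,2) this] \<omega>(3) n have "K * real n < L \<omega>"
          by (simp add: pos_less_divide_eq)
        with le_X[OF \<omega>(1,2) False] \<omega>(1) show ?thesis by simp
      qed simp
    qed
  qed (use T Bad in auto)
  also have "\<dots> \<le> prob ?T + prob Bad" using T Bad by (intro measure_Un_le) auto
  also have "prob ?T \<le> expectation X / (K * real n)"
  proof (rule integral_Markov_inequality_measure[OF int_X T])
    have "0 \<le> X \<omega>" for \<omega>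
      unfolding X_def C_def by (intro add_nonneg_nonneg mult_nonneg_nonneg sum_nonneg) auto
    then show "AE \<omega> in M. 0 \<le> X \<omega>" by simp
  qed (use K n in auto)
  also have "\<dots> \<le> 2048 * real n / (K * real n)" using E_X K n by (intro divide_right_mono) auto
  also have "\<dots> = 2048 / K" using n by simp
  also have "prob Bad \<le> 2 * (real n)\<^sup>2 * (7 / 8) ^ (n - 2)" by (rule Bad(2))
  finally show ?thesis by (simp add: L_def complete_edges_def)
qed

subsection \<open>Tightness\<close>

text \<open>The tail is one minus the distribution function of the absolute value, which tends to
  1.\<close>

lemma (in prob_space) prob_abs_gt_tendsto_0:
  fixes X :: "'a \<Rightarrow> real"
  assumes X: "X \<in> borel_measurable M"
  shows "((\<lambda>K. prob {\<omega> \<in> space M. \<bar>X \<omega>\<bar> > K}) \<longlongrightarrow> 0) at_top"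
proof -
  have [measurable]: "(\<lambda>\<omega>. \<bar>X \<omega>\<bar>) \<in> borel_measurable M" using X by simp
  interpret Y: real_distribution "distr M borel (\<lambda>\<omega>. \<bar>X \<omega>\<bar>)" by simp
  have "prob {\<omega> \<in> space M. \<bar>X \<omega>\<bar> > K} = 1 - cdf (distr M borel (\<lambda>\<omega>. \<bar>X \<omega>\<bar>)) K" for K
  proof -
    have "cdf (distr M borel (\<lambda>\<omega>. \<bar>X \<omega>\<bar>)) K = prob {\<omega> \<in> space M. \<bar>X \<omega>\<bar> \<le> K}"
      unfolding cdf_def by (subst measure_distr) (auto intro!: arg_cong[where f = prob])
    moreover have "prob {\<omega> \<in> space M. \<not> \<bar>X \<omega>\<bar> \<le> K} = 1 - prob {\<omega> \<in> space M. \<bar>X \<omega>\<bar> \<le> K}"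
      by (rule prob_neg) measurable
    ultimately show ?thesis by (simp add: not_le)
  qed
  moreover have "((\<lambda>K. 1 - cdf (distr M borel (\<lambda>\<omega>. \<bar>X \<omega>\<bar>)) K) \<longlongrightarrow> 1 - 1) at_top"
    by (intro tendsto_intros Y.cdf_lim_at_top_prob)
  ultimately show ?thesis by simp
qed

text \<open>Finitely many indices are harmless for tightness, since a single random variable is tight.\<close>

lemma tight_rvs_of_eventually:
  assumes ps: "\<And>n. n \<in> I \<Longrightarrow> prob_space (M n)" and "I \<noteq> {}"
    and X: "\<And>n. n \<in> I \<Longrightarrow> X n \<in> borel_measurable (M n)"
    and bound: "\<And>n K. n \<in> I \<Longrightarrow> n \<ge> N \<Longrightarrow> K > 0 \<Longrightarrow>
      measure (M n) {\<omega> \<in> space (M n). \<bar>X n \<omega>\<bar> > K} \<le> C / K + b n"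
    and b: "b \<longlonglongrightarrow> (0 :: real)"
  shows "tight_rvs I M X"
  unfolding tight_rvs_def
proof (intro conjI ballI X order_tendstoI)
  define p where "p K n = measure (M n) {\<omega> \<in> space (M n). \<bar>X n \<omega>\<bar> > K}" for K n
  have p: "0 \<le> p K n" "p K n \<le> 1" if "n \<in> I" for K n
    using prob_space.prob_le_1[OF ps[OF that]] by (auto simp: p_def)
  fix \<epsilon> :: real
  show "eventually (\<lambda>K. \<epsilon> < (SUP n\<in>I. measure (M n) {\<omega> \<in> space (M n). \<bar>X n \<omega>\<bar> > K})) at_top"
    if "\<epsilon> < 0"
  proof (rule always_eventually, rule allI)
    fix K
    obtain n where n: "n \<in> I" using \<open>I \<noteq> {}\<close> by auto
    have "0 \<le> p K n" by (rule p[OF n])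
    also have "\<dots> \<le> (SUP n\<in>I. p K n)"
      using p(2) n by (intro cSUP_upper bdd_aboveI2)
    finally show "\<epsilon> < (SUP n\<in>I. measure (M n) {\<omega> \<in> space (M n). \<bar>X n \<omega>\<bar> > K})"
      using that by (simp add: p_def)
  qed
  assume \<epsilon>: "0 < \<epsilon>"
  \<comment> \<open>\<open>b n\<close> and \<open>C / K\<close> get \<open>\<epsilon> / 4\<close>
    each. The resulting \<open>\<epsilon> / 2\<close> for every \<open>n\<close> leaves room for the
    supremum, which preserves only weak inequalities.\<close>
  from order_tendstoD(2)[OF b, of "\<epsilon> / 4"] \<epsilon> obtain N0 where N0: "b n < \<epsilon> / 4" if "n \<ge> N0" for n
    by (auto simp: eventually_sequentially)
  \<comment> \<open>The indices below \<open>max N N0\<close> are finitely many, so a single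
    \<open>K\<close> serves all their tails.\<close>
  have "eventually (\<lambda>K. \<forall>n\<in>I \<inter> {..<max N N0}. p K n < \<epsilon> / 2) at_top"
  proof (rule eventually_ball_finite)
    show "\<forall>n\<in>I \<inter> {..<max N N0}. eventually (\<lambda>K. p K n < \<epsilon> / 2) at_top"
      unfolding p_def using \<epsilon>
      by (intro ballI order_tendstoD(2)[OF prob_space.prob_abs_gt_tendsto_0[OF ps X]]) auto
  qed simp
  moreover have "((\<lambda>K. C / K) \<longlongrightarrow> 0) at_top" by real_asymp
  then have "eventually (\<lambda>K. C / K < \<epsilon> / 4) at_top"
    using \<epsilon> by (intro order_tendstoD(2)) auto
  ultimately show "eventually (\<lambda>K. (SUP n\<in>I. measure (M n) {\<omega> \<in> space (M n). \<bar>X n \<omega>\<bar> > K}) < \<epsilon>) at_top"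
    using eventually_gt_at_top[of 0]
  proof eventually_elim
    case (elim K)
    have "p K n \<le> \<epsilon> / 2" if n: "n \<in> I" for n
    proof (cases "n < max N N0")
      case True
      then show ?thesis using elim(1) n by force
    next
      case False
      then have "p K n \<le> C / K + b n" "b n < \<epsilon> / 4"
        using bound[of n K] N0[of n] n elim(3) by (auto simp: p_def)
      then show ?thesis using elim(2) by linarith
    qed
    then have "(SUP n\<in>I. p K n) \<le> \<epsilon> / 2" using \<open>I \<noteq> {}\<close> by (intro cSUP_least) auto
    then show ?case using \<epsilon> by (simp add: p_def)
  qed
qed

theorem corollary7:
  fixes M :: "nat \<Rightarrow> 'a measure"
    and len :: "nat \<Rightarrow> nat set \<Rightarrow> 'a \<Rightarrow> real"
    and v0 :: "nat \<Rightarrow> nat"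
  assumes "\<And>n. n \<ge> 2 \<Longrightarrow> mean_field_model n (M n) (len n)"
    and "\<And>n. n \<ge> 2 \<Longrightarrow> v0 n \<in> {..<n}"
  shows "tight_rvs {2..} M
    (\<lambda>n \<omega>. L_NUV {..<n} (complete_edges n) (\<lambda>e. len n e \<omega>) (v0 n) / real n)"
proof (rule tight_rvs_of_eventually[where N = 64 and C = 2048
      and b = "\<lambda>n. 2 * (real n)\<^sup>2 * (7 / 8) ^ (n - 2)"])
  fix n :: nat assume "n \<in> {2..}"
  then have mf: "mean_field_model n (M n) (len n)" and v0: "v0 n < n" using assms by auto
  show "prob_space (M n)" using mf by (simp add: mean_field_model_def)
  have "len n e \<in> borel_measurable (M n)" if "e \<in> complete_edges n" for e
    using mf that distributed_measurable[of "M n" lborel "len n e"]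
    by (auto simp: mean_field_model_def)
  then have "(\<lambda>\<omega>. L_NUV {..<n} (complete_edges n) (\<lambda>e. len n e \<omega>) (v0 n)) \<in> borel_measurable (M n)"
    by (intro measurable_L_NUV) auto
  then show "(\<lambda>\<omega>. L_NUV {..<n} (complete_edges n) (\<lambda>e. len n e \<omega>) (v0 n) / real n)
      \<in> borel_measurable (M n)" by simp
  show "measure (M n) {\<omega> \<in> space (M n).
      \<bar>L_NUV {..<n} (complete_edges n) (\<lambda>e. len n e \<omega>) (v0 n) / real n\<bar> > K}
    \<le> 2048 / K + 2 * (real n)\<^sup>2 * (7 / 8) ^ (n - 2)" if "n \<ge> 64" "K > 0" for K
    by (rule prob_L_NUV_gt_le[OF mf that(1) v0 that(2)])
next
  \<comment> \<open>The factor \<open>64 / 49\<close> is \<open>(8 / 7)\<^sup>2\<close>; it replaces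
    the truncated subtraction in the exponent, and the two forms agree from \<open>n = 2\<close>
    on.\<close>
  have "(\<lambda>n. 2 * (real n)\<^sup>2 * ((7 / 8) ^ n * (64 / 49))) \<longlonglongrightarrow> 0" by real_asymp
  moreover have "eventually (\<lambda>n. 2 * (real n)\<^sup>2 * ((7 / 8) ^ n * (64 / 49)) =
      2 * (real n)\<^sup>2 * (7 / 8) ^ (n - 2)) sequentially"
    using eventually_ge_at_top[of 2]
  proof eventually_elim
    case (elim n)
    then obtain m where "n = m + 2" by (metis add.commute le_Suc_ex)
    then show ?case by (simp add: power_add power2_eq_square)
  qed
  ultimately show "(\<lambda>n. 2 * (real n)\<^sup>2 * (7 / 8 :: real) ^ (n - 2)) \<longlonglongrightarrow> 0"
    by (rule Lim_transform_eventually)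
qed simp

end
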